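(* Let $R_X$ be a punctual equivalence relation. The lowercone $\{\deg(R_Y)\mid R_Y\leq_{pr}R_X\}$ below $R_X$, as a suborder of $\mathbf{Peq}$, is not isomorphic to $(\mathbf{Peq},\leq)$ unless $R_X\equiv_{pr}\mathrm{Id}$. Thus, no proper lowercone is isomorphic to $(\mathbf{Peq},\leq)$.
   Context: A punctual equivalence relation is a primitive recursive equivalence relation with domain $\omega$ having infinitely many equivalence classes. $\mathrm{Id}$ is equality on $\omega$. For equivalence relations $R,S$ on $\omega$, $R\leq_{pr} S$ means that there is a primitive recursive function $f:\omega\to\omega$ such that for all $x,y\in\omega$, $x\mathrel{R}y \Leftrightarrow f(x)\mathrel{S}f(y)$. Write $R\equiv_{pr}S$ if $R\leq_{pr}S$ and $S\leq_{pr}R$. $(\mathbf{Peq},\leq)$ is the partial order of $\equiv_{pr}$-classes $\deg(R)$ of punctual equivalence relations $R$, ordered by the order induced by $\leq_{pr}$; its greatest element is $\deg(\mathrm{Id})$. For $X\subseteq\omega$, $R_X$ is given by $x\mathrel{R_X}y \Leftrightarrow (x,y\in X \text{ or } x=y)$. In the lowercone, $R_Y$ ranges over punctual equivalence relations with $Y\subseteq\omega$ primitive recursive; every punctual equivalence relation is $\equiv_{pr}$-equivalent to one of this form. A lowercone is proper if it is not all of $\mathbf{Peq}$. *)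

theory Defs
  imports Main
begin

section \<open>Primitive recursive functions\<close>

text \<open>\<open>primitive_rec n F\<close>: the restriction of \<open>F\<close> to lists of length \<open>n\<close> is an \<open>n\<close>-ary primitive
  recursive function. Values of \<open>F\<close> on lists of other lengths carry no meaning.\<close>

inductive primitive_rec :: "nat \<Rightarrow> (nat list \<Rightarrow> nat) \<Rightarrow> bool" where
  zero: "primitive_rec n (\<lambda>_. 0)"
| succ: "primitive_rec 1 (\<lambda>xs. Suc (hd xs))"
| proj: "i < n \<Longrightarrow> primitive_rec n (\<lambda>xs. xs ! i)"
| comp: "primitive_rec (length Gs) F \<Longrightarrow> (\<forall>G\<in>set Gs. primitive_rec n G) \<Longrightarrow>
    primitive_rec n (\<lambda>xs. F (map (\<lambda>G. G xs) Gs))"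
| recursion: "primitive_rec n F \<Longrightarrow> primitive_rec (Suc (Suc n)) G \<Longrightarrow>
    primitive_rec (Suc n)
      (\<lambda>xs. rec_nat (F (tl xs)) (\<lambda>k r. G (k # r # tl xs)) (hd xs))"

definition primitive_rec_fun :: "(nat \<Rightarrow> nat) \<Rightarrow> bool" where
  "primitive_rec_fun f \<longleftrightarrow> (\<exists>F. primitive_rec 1 F \<and> (\<forall>x. f x = F [x]))"

definition primitive_rec_set :: "nat set \<Rightarrow> bool" where
  "primitive_rec_set X \<longleftrightarrow> (\<exists>F. primitive_rec 1 F \<and> (\<forall>x. F [x] = of_bool (x \<in> X)))"

definition primitive_rec_rel :: "nat rel \<Rightarrow> bool" where
  "primitive_rec_rel R \<longleftrightarrow>
    (\<exists>F. primitive_rec 2 F \<and> (\<forall>x y. F [x, y] = of_bool ((x, y) \<in> R)))"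


section \<open>Punctual equivalence relations and their degrees\<close>

definition punctual :: "nat rel \<Rightarrow> bool" where
  "punctual R \<longleftrightarrow> equiv UNIV R \<and> primitive_rec_rel R \<and> infinite (UNIV // R)"

definition pr_reducible :: "nat rel \<Rightarrow> nat rel \<Rightarrow> bool" (infix \<open>\<le>\<^sub>p\<^sub>r\<close> 50) where
  "R \<le>\<^sub>p\<^sub>r S \<longleftrightarrow> (\<exists>f. primitive_rec_fun f \<and> (\<forall>x y. (x, y) \<in> R \<longleftrightarrow> (f x, f y) \<in> S))"

definition pr_equivalent :: "nat rel \<Rightarrow> nat rel \<Rightarrow> bool" (infix \<open>\<equiv>\<^sub>p\<^sub>r\<close> 50) where
  "R \<equiv>\<^sub>p\<^sub>r S \<longleftrightarrow> R \<le>\<^sub>p\<^sub>r S \<and> S \<le>\<^sub>p\<^sub>r R"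

definition deg :: "nat rel \<Rightarrow> nat rel set" where
  "deg R = {S. punctual S \<and> R \<equiv>\<^sub>p\<^sub>r S}"

definition Peq :: "nat rel set set" where
  "Peq = deg ` {R. punctual R}"

definition deg_le :: "nat rel set \<Rightarrow> nat rel set \<Rightarrow> bool" where
  "deg_le d e \<longleftrightarrow> (\<exists>R\<in>d. \<exists>S\<in>e. R \<le>\<^sub>p\<^sub>r S)"

definition R_of :: "nat set \<Rightarrow> nat rel" where
  "R_of X = {(x, y). (x \<in> X \<and> y \<in> X) \<or> x = y}"

definition lowercone :: "nat rel \<Rightarrow> nat rel set set" where
  "lowercone R = {deg (R_of Y) |Y. primitive_rec_set Y \<and> punctual (R_of Y) \<and> R_of Y \<le>\<^sub>p\<^sub>r R}"

text \<open>Isomorphism of two suborders of the order \<^const>\<open>deg_le\<close>.\<close>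

definition deg_order_isomorphic :: "nat rel set set \<Rightarrow> nat rel set set \<Rightarrow> bool" where
  "deg_order_isomorphic A B \<longleftrightarrow>
    (\<exists>h. bij_betw h A B \<and> (\<forall>d\<in>A. \<forall>e\<in>A. deg_le d e \<longleftrightarrow> deg_le (h d) (h e)))"


section \<open>The order on degrees is well defined\<close>

lemma pr_reducible_refl: "R \<le>\<^sub>p\<^sub>r R"
proof -
  have "primitive_rec 1 (\<lambda>xs. xs ! 0)" by (rule primitive_rec.proj) simp
  then have "primitive_rec_fun (\<lambda>x. x)" unfolding primitive_rec_fun_def by force
  then show ?thesis unfolding pr_reducible_def by blast
qed

lemma pr_reducible_trans: assumes "R \<le>\<^sub>p\<^sub>r S" "S \<le>\<^sub>p\<^sub>r T" shows "R \<le>\<^sub>p\<^sub>r T"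
proof -
  obtain f F where f: "primitive_rec 1 F" "\<And>x. f x = F [x]"
      "\<And>x y. (x, y) \<in> R \<longleftrightarrow> (f x, f y) \<in> S"
    using assms(1) unfolding pr_reducible_def primitive_rec_fun_def by blast
  obtain g G where g: "primitive_rec 1 G" "\<And>x. g x = G [x]"
      "\<And>x y. (x, y) \<in> S \<longleftrightarrow> (g x, g y) \<in> T"
    using assms(2) unfolding pr_reducible_def primitive_rec_fun_def by blast
  have "primitive_rec 1 (\<lambda>xs. G (map (\<lambda>H. H xs) [F]))"
    using f(1) g(1) by (intro primitive_rec.comp) auto
  then have "primitive_rec_fun (\<lambda>x. g (f x))"
    unfolding primitive_rec_fun_def using f(2) g(2) by force
  then show ?thesis unfolding pr_reducible_def using f(3) g(3) by blast
qed

lemma deg_le_deg_iff: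
  assumes "punctual R" "punctual S"
  shows "deg_le (deg R) (deg S) \<longleftrightarrow> R \<le>\<^sub>p\<^sub>r S"
  using assms pr_reducible_refl pr_reducible_trans
  unfolding deg_le_def deg_def pr_equivalent_def by blast

lemma deg_eq_iff:
  assumes "punctual R" "punctual S"
  shows "deg R = deg S \<longleftrightarrow> R \<equiv>\<^sub>p\<^sub>r S"
  using assms pr_reducible_refl pr_reducible_trans
  unfolding deg_def pr_equivalent_def by blast

end

theory Submission
  imports Defs "HOL-Library.Nat_Bijection"
begin

text \<open>
  A punctual equivalence relation \<open>R\<close> is determined, up to
  \<open>\<equiv>\<^sub>p\<^sub>r\<close>, by the pace at which its classes appear: if \<open>class_count R
  n\<close> is the number of classes that meet \<open>{0..<n}\<close>, then \<open>R \<le>\<^sub>p\<^sub>r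
  S\<close> holds iff \<open>class_count R n \<le> class_count S (p n)\<close> for some primitive recursive
  \<open>p\<close>. Up to rescaling, every primitive recursive, monotone, unbounded function occurs as such a
  pace. So \<open>Peq\<close> is the order of these growth rates modulo primitive recursive rescaling of the
  argument, with the identity on top, and a lowercone consists of the growth rates below some
  \<open>g\<close>. Joins and meets are pointwise maxima and minima.

  A property of orders, \<open>splits_covers\<close>, distinguishes the two. It asks for an element
  \<open>f\<close> below the top such that any \<open>a, b \<ge> f\<close> with join the top have refinements
  \<open>c \<le> a\<close> and \<open>d \<le> b\<close> whose join is still the top and whose meet is below
  \<open>f\<close>.

  The cone below \<open>g\<close> has the property if \<open>g\<close> is not equivalent to the identity
  (\<open>splits_covers_cone\<close>), by way of \<open>f = g - 1\<close>. This is strictly below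
  \<open>g\<close>, for otherwise \<open>g\<close> would grow by one with each application of a fixed
  primitive recursive function and so would reach the identity. Since \<open>f\<close> and \<open>g\<close>
  differ by a single unit, at each value of \<open>g\<close> one of \<open>a\<close> and \<open>b\<close>
  provides this unit in time, and it can be given to \<open>c\<close> or to \<open>d\<close> as a whole.

  In \<open>Peq\<close> the property fails (\<open>not_splits_covers_growth\<close>). If \<open>f\<close> is
  strictly below the identity, then \<open>f\<close> has pauses whose lengths are not bounded by a primitive
  recursive function of their starting points. Let \<open>a\<close> follow the identity on the first part of
  each pause and rest on the second, and let \<open>b\<close> do the opposite. If both parts are long,
  \<open>c\<close> has to grow in the first part and \<open>d\<close> in the second, and then both exceed
  \<open>f\<close>, which is still in its pause. The difficulty is to choose the point of exchange: it must be
  known when it is reached, although the length of the pause is not known yet. The solution is to measure by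
  the fast-growing hierarchy \<open>hier\<close>, which dominates all primitive recursive functions and has a
  primitive recursive graph. The level used for a pause is the number of earlier pauses that were long enough
  for the level used then; this number tends to infinity, and infinitely many pauses are long enough for it
  (\<open>pause_at_level\<close>).
\<close>

section \<open>Closure properties of primitive recursion\<close>

text \<open>\<open>primitive_rec\<close> is not closed under changing a function on lists of the wrong length.
  \<open>pr_fun\<close> closes it under such changes, so that a function may be given by any term with the
  right values on lists of length \<open>n\<close>.\<close>

definition pr_fun :: "nat \<Rightarrow> (nat list \<Rightarrow> nat) \<Rightarrow> bool" where
  "pr_fun n F \<longleftrightarrow> (\<exists>F'. primitive_rec n F' \<and> (\<forall>xs. length xs = n \<longrightarrow> F xs = F' xs))"

lemma pr_cong:
  assumes "pr_fun n F" "\<And>xs. length xs = n \<Longrightarrow> G xs = F xs"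
  shows "pr_fun n G"
  using assms unfolding pr_fun_def by metis

lemma pr_comp:
  assumes "pr_fun (length Gs) F" "\<And>G. G \<in> set Gs \<Longrightarrow> pr_fun n G"
  shows "pr_fun n (\<lambda>xs. F (map (\<lambda>G. G xs) Gs))"
proof -
  obtain F' where F': "primitive_rec (length Gs) F'" "\<And>xs. length xs = length Gs \<Longrightarrow> F xs = F' xs"
    using assms(1) unfolding pr_fun_def by blast
  obtain H where H: "\<And>G. G \<in> set Gs \<Longrightarrow> primitive_rec n (H G)"
      "\<And>G xs. G \<in> set Gs \<Longrightarrow> length xs = n \<Longrightarrow> G xs = H G xs"
    using assms(2) unfolding pr_fun_def by metis
  have "primitive_rec n (\<lambda>xs. F' (map (\<lambda>G. G xs) (map H Gs)))"
    using F'(1) H(1) by (intro primitive_rec.comp) auto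
  moreover have "F (map (\<lambda>G. G xs) Gs) = F' (map (\<lambda>G. G xs) (map H Gs))" if "length xs = n" for xs
    using F'(2) H(2) that by (simp add: comp_def cong: map_cong)
  ultimately show ?thesis unfolding pr_fun_def by blast
qed

lemma pr_nth: "i < n \<Longrightarrow> pr_fun n (\<lambda>xs. xs ! i)"
  unfolding pr_fun_def using primitive_rec.proj by blast

lemma pr_nth_drop: "d + i < n \<Longrightarrow> pr_fun n (\<lambda>xs. drop d xs ! i)"
  by (rule pr_cong[OF pr_nth[of "d + i"]]) auto

lemma pr_nth_drop_drop: "d + e + i < n \<Longrightarrow> pr_fun n (\<lambda>xs. drop d (drop e xs) ! i)"
  by (rule pr_cong[OF pr_nth[of "d + e + i"]]) (auto simp: algebra_simps)

lemma pr_Suc: "pr_fun n G \<Longrightarrow> pr_fun n (\<lambda>xs. Suc (G xs))"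
proof -
  assume "pr_fun n G"
  moreover have "pr_fun 1 (\<lambda>xs. Suc (hd xs))"
    unfolding pr_fun_def using primitive_rec.succ by blast
  ultimately show ?thesis using pr_comp[of "[G]" "\<lambda>xs. Suc (hd xs)" n] by simp
qed

lemma pr_const: "pr_fun n (\<lambda>_. c)"
proof (induction c)
  case 0
  then show ?case unfolding pr_fun_def using primitive_rec.zero by blast
next
  case (Suc c)
  then show ?case using pr_Suc by fast
qed

text \<open>The step function is stated with its list argument written as \<open>drop 2 ys\<close>, and
  similarly for the bounded operations below with \<open>drop 1\<close>. Under a binder, a variable then takes
  the form \<open>drop d xs ! i\<close>, so that the closure rules can be applied to a term syntactically,
  from the outside inwards.\<close>

lemma pr_rec:
  assumes F: "pr_fun n F" and G: "pr_fun (Suc (Suc n)) (\<lambda>ys. G (ys ! 0) (ys ! 1) (drop 2 ys))"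
    and B: "pr_fun n B"
  shows "pr_fun n (\<lambda>xs. rec_nat (F xs) (\<lambda>k r. G k r xs) (B xs))"
proof -
  obtain F' where F': "primitive_rec n F'" "\<And>xs. length xs = n \<Longrightarrow> F xs = F' xs"
    using F unfolding pr_fun_def by blast
  obtain G' where G': "primitive_rec (Suc (Suc n)) G'"
      "\<And>ys. length ys = Suc (Suc n) \<Longrightarrow> G (ys ! 0) (ys ! 1) (drop 2 ys) = G' ys"
    using G unfolding pr_fun_def by blast
  let ?R = "\<lambda>xs. rec_nat (F' (tl xs)) (\<lambda>k r. G' (k # r # tl xs)) (hd xs)"
  let ?Gs = "B # map (\<lambda>i xs. xs ! i) [0..<n]"
  have R: "pr_fun (length ?Gs) ?R"
    unfolding pr_fun_def using primitive_rec.recursion[OF F'(1) G'(1)] by auto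
  have "pr_fun n (\<lambda>xs. ?R (map (\<lambda>G. G xs) ?Gs))"
    using R by (rule pr_comp) (auto intro: B pr_nth)
  then show ?thesis
  proof (rule pr_cong)
    fix xs :: "nat list" assume l: "length xs = n"
    have m: "map (\<lambda>i. xs ! i) [0..<n] = xs" using l map_nth by blast
    have "G k r xs = G' (k # r # xs)" for k r using G'(2)[of "k # r # xs"] l by simp
    then show "rec_nat (F xs) (\<lambda>k r. G k r xs) (B xs) = ?R (map (\<lambda>G. G xs) ?Gs)"
      using l m by (simp add: F'(2) comp_def)
  qed
qed

lemma primitive_rec_fun_iff: "primitive_rec_fun f \<longleftrightarrow> pr_fun 1 (\<lambda>xs. f (xs ! 0))"
proof
  assume "primitive_rec_fun f"
  then obtain F where F: "primitive_rec 1 F" "\<And>x. f x = F [x]"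
    unfolding primitive_rec_fun_def by blast
  have "f (xs ! 0) = F xs" if "length xs = 1" for xs
    using that by (auto simp: length_Suc_conv F(2))
  then show "pr_fun 1 (\<lambda>xs. f (xs ! 0))" using F(1) unfolding pr_fun_def by blast
next
  assume "pr_fun 1 (\<lambda>xs. f (xs ! 0))"
  then obtain F where F: "primitive_rec 1 F" "\<And>xs. length xs = 1 \<Longrightarrow> f (xs ! 0) = F xs"
    unfolding pr_fun_def by blast
  then have "f x = F [x]" for x using F(2)[of "[x]"] by simp
  then show "primitive_rec_fun f" unfolding primitive_rec_fun_def using F(1) by blast
qed

lemma pr_app: "primitive_rec_fun f \<Longrightarrow> pr_fun n G \<Longrightarrow> pr_fun n (\<lambda>xs. f (G xs))"
  using pr_comp[of "[G]" "\<lambda>xs. f (xs ! 0)" n] by (simp add: primitive_rec_fun_iff)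

lemma pr_app2:
  assumes "pr_fun 2 (\<lambda>xs. f (xs ! 0) (xs ! 1))" "pr_fun n G" "pr_fun n H"
  shows "pr_fun n (\<lambda>xs. f (G xs) (H xs))"
proof -
  have "pr_fun n (\<lambda>xs. (\<lambda>ys. f (ys ! 0) (ys ! 1)) (map (\<lambda>G. G xs) [G, H]))"
    using assms by (intro pr_comp) (auto simp: numeral_2_eq_2)
  then show ?thesis by simp
qed

lemma pr_app3:
  assumes "pr_fun 3 (\<lambda>xs. f (xs ! 0) (xs ! 1) (xs ! 2))" "pr_fun n G" "pr_fun n H" "pr_fun n K"
  shows "pr_fun n (\<lambda>xs. f (G xs) (H xs) (K xs))"
proof -
  have "pr_fun n (\<lambda>xs. (\<lambda>ys. f (ys ! 0) (ys ! 1) (ys ! 2)) (map (\<lambda>G. G xs) [G, H, K]))"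
    using assms by (intro pr_comp) (auto simp: numeral_3_eq_3 numeral_2_eq_2)
  then show ?thesis by (simp add: numeral_2_eq_2)
qed

lemma pr_add: assumes "pr_fun n G" "pr_fun n H" shows "pr_fun n (\<lambda>xs. G xs + H xs)"
proof (rule pr_app2[OF _ assms])
  have "rec_nat x (\<lambda>k r. Suc r) y = x + y" for x y by (induction y) auto
  then show "pr_fun 2 (\<lambda>xs. xs ! 0 + xs ! 1)"
    using pr_rec[of 2 "\<lambda>xs. xs ! 0" "\<lambda>k r xs. Suc r" "\<lambda>xs. xs ! 1"]
    by (simp add: pr_nth pr_Suc)
qed

lemma pr_mult: assumes "pr_fun n G" "pr_fun n H" shows "pr_fun n (\<lambda>xs. G xs * H xs)"
proof (rule pr_app2[OF _ assms])
  have "rec_nat 0 (\<lambda>k r. x + r) y = x * y" for x y by (induction y) auto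
  then show "pr_fun 2 (\<lambda>xs. xs ! 0 * xs ! 1)"
    using pr_rec[of 2 "\<lambda>xs. 0" "\<lambda>k r xs. xs ! 0 + r" "\<lambda>xs. xs ! 1"]
    by (simp add: pr_nth pr_const pr_add pr_nth_drop)
qed

lemma pr_diff: assumes "pr_fun n G" "pr_fun n H" shows "pr_fun n (\<lambda>xs. G xs - H xs)"
proof (rule pr_app2[OF _ assms])
  have "rec_nat 0 (\<lambda>k r. k) y = y - 1" for y by (cases y) auto
  then have "pr_fun 1 (\<lambda>xs. xs ! 0 - 1)"
    using pr_rec[of 1 "\<lambda>xs. 0" "\<lambda>k r xs. k" "\<lambda>xs. xs ! 0"]
    by (simp add: pr_nth pr_const)
  then have pred: "primitive_rec_fun (\<lambda>x. x - 1)" by (simp add: primitive_rec_fun_iff)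
  have "rec_nat x (\<lambda>k r. r - 1) y = x - y" for x y by (induction y) auto
  moreover have "pr_fun 2 (\<lambda>xs. rec_nat (xs ! 0) (\<lambda>k r. r - 1) (xs ! 1))"
    by (intro pr_rec pr_nth pr_app[OF pred]) auto
  ultimately show "pr_fun 2 (\<lambda>xs. xs ! 0 - xs ! 1)" by simp
qed

abbreviation dec :: "nat \<Rightarrow> (nat list \<Rightarrow> bool) \<Rightarrow> bool" where
  "dec n P \<equiv> pr_fun n (\<lambda>xs. of_bool (P xs))"

lemma pr_sum:
  assumes "pr_fun n B" "pr_fun (Suc n) (\<lambda>ys. G (ys ! 0) (drop 1 ys))"
  shows "pr_fun n (\<lambda>xs. \<Sum>k<B xs. G k xs)"
proof -
  have "pr_fun (Suc n) (\<lambda>ys. G (ys ! 0) (drop (Suc 0) ys))" using assms(2) by simp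
  then have "pr_fun (Suc (Suc n)) (\<lambda>ys. (\<lambda>zs. G (zs ! 0) (drop (Suc 0) zs))
      (map (\<lambda>H. H ys) ((\<lambda>ys. ys ! 0) # map (\<lambda>i ys. ys ! (i + 2)) [0..<n])))"
    by (intro pr_comp) (auto intro!: pr_nth)
  then have "pr_fun (Suc (Suc n)) (\<lambda>ys. G (ys ! 0) (drop 2 ys))"
  proof (rule pr_cong)
    fix ys :: "nat list" assume "length ys = Suc (Suc n)"
    then have "map (\<lambda>i. ys ! (i + 2)) [0..<n] = drop 2 ys"
      by (auto intro!: nth_equalityI simp: add.commute)
    then show "G (ys ! 0) (drop 2 ys) = (\<lambda>zs. G (zs ! 0) (drop (Suc 0) zs))
      (map (\<lambda>H. H ys) ((\<lambda>ys. ys ! 0) # map (\<lambda>i ys. ys ! (i + 2)) [0..<n]))"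
      by (simp add: comp_def)
  qed
  then have "pr_fun n (\<lambda>xs. rec_nat 0 (\<lambda>k r. r + G k xs) (B xs))"
    by (intro pr_rec pr_const pr_add assms(1)) (auto intro!: pr_nth)
  moreover have "rec_nat 0 (\<lambda>k r. r + G k xs) m = (\<Sum>k<m. G k xs)" for m xs
    by (induction m) auto
  ultimately show ?thesis by simp
qed

lemma dec_le: "pr_fun n G \<Longrightarrow> pr_fun n H \<Longrightarrow> dec n (\<lambda>xs. G xs \<le> H xs)"
proof -
  assume "pr_fun n G" "pr_fun n H"
  then have "pr_fun n (\<lambda>xs. 1 - (G xs - H xs))" by (intro pr_diff pr_const)
  then show ?thesis by (rule pr_cong) auto
qed

lemma dec_not: "dec n P \<Longrightarrow> dec n (\<lambda>xs. \<not> P xs)"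
  by (rule pr_cong[OF pr_diff[OF pr_const[of _ 1]]]) auto

lemma dec_conj: "dec n P \<Longrightarrow> dec n Q \<Longrightarrow> dec n (\<lambda>xs. P xs \<and> Q xs)"
  by (rule pr_cong[OF pr_mult[of n "\<lambda>xs. of_bool (P xs)" "\<lambda>xs. of_bool (Q xs)"]]) auto

lemma dec_disj: "dec n P \<Longrightarrow> dec n Q \<Longrightarrow> dec n (\<lambda>xs. P xs \<or> Q xs)"
  by (rule pr_cong[OF dec_not[OF dec_conj[OF dec_not[of n P] dec_not[of n Q]]]]) auto

lemma dec_less: "pr_fun n G \<Longrightarrow> pr_fun n H \<Longrightarrow> dec n (\<lambda>xs. G xs < H xs)"
  by (rule pr_cong[OF dec_not[OF dec_le[of n H G]]]) auto

lemma dec_eq: "pr_fun n G \<Longrightarrow> pr_fun n H \<Longrightarrow> dec n (\<lambda>xs. G xs = H xs)"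
  by (rule pr_cong[OF dec_conj[OF dec_le[of n G H] dec_le[of n H G]]]) auto

lemma dec_ex:
  assumes "pr_fun n B" "dec (Suc n) (\<lambda>ys. P (ys ! 0) (drop 1 ys))"
  shows "dec n (\<lambda>xs. \<exists>k<B xs. P k xs)"
proof -
  have "dec n (\<lambda>xs. 0 < (\<Sum>k<B xs. of_bool (P k xs) :: nat))"
    by (intro dec_less pr_const pr_sum assms)
  moreover have "0 < (\<Sum>k<m. of_bool (P k xs) :: nat) \<longleftrightarrow> (\<exists>k<m. P k xs)" for m xs
    by (induction m) (auto simp: less_Suc_eq)
  ultimately show ?thesis by simp
qed

lemma dec_all:
  assumes "pr_fun n B" "dec (Suc n) (\<lambda>ys. P (ys ! 0) (drop 1 ys))"
  shows "dec n (\<lambda>xs. \<forall>k<B xs. P k xs)"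
  using dec_not[OF dec_ex[OF assms(1) dec_not[OF assms(2)]]] by simp

lemma pr_if:
  "dec n P \<Longrightarrow> pr_fun n G \<Longrightarrow> pr_fun n H \<Longrightarrow> pr_fun n (\<lambda>xs. if P xs then G xs else H xs)"
proof -
  assume "dec n P" "pr_fun n G" "pr_fun n H"
  then have "pr_fun n (\<lambda>xs. of_bool (P xs) * G xs + of_bool (\<not> P xs) * H xs)"
    by (intro pr_add pr_mult dec_not)
  then show ?thesis by (rule pr_cong) auto
qed

lemma pr_min: "pr_fun n G \<Longrightarrow> pr_fun n H \<Longrightarrow> pr_fun n (\<lambda>xs. min (G xs) (H xs))"
  unfolding min_def by (intro pr_if dec_le)

lemma pr_max: "pr_fun n G \<Longrightarrow> pr_fun n H \<Longrightarrow> pr_fun n (\<lambda>xs. max (G xs) (H xs))"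
  unfolding max_def by (intro pr_if dec_le)

lemmas pr_intros = pr_nth pr_nth_drop pr_nth_drop_drop pr_const pr_Suc
  pr_add pr_mult pr_diff pr_if pr_min pr_max pr_sum
  dec_le dec_less dec_eq dec_conj dec_disj dec_not dec_ex dec_all

text \<open>Bounded search for a unique witness, written as a sum so that \<open>pr_sum\<close> shows it to be
  primitive recursive.\<close>

lemma sum_unique_index:
  fixes z b :: nat
  assumes "z < b" "P z" "\<And>y. y < b \<Longrightarrow> P y \<Longrightarrow> y = z"
  shows "(\<Sum>y<b. y * of_bool (P y)) = z"
proof -
  have "(\<Sum>y<b. y * of_bool (P y)) = (\<Sum>y<b. if y = z then z else 0)"
    by (rule sum.cong) (use assms(2) in \<open>auto dest: assms(3)\<close>)
  then show ?thesis using assms(1) by simp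
qed

lemma pr_prod_encode:
  assumes "pr_fun n G" "pr_fun n H" shows "pr_fun n (\<lambda>xs. prod_encode (G xs, H xs))"
proof -
  have t: "(\<Sum>k<Suc m. k) = triangle m" for m by (induction m) auto
  have "pr_fun n (\<lambda>xs. (\<Sum>k<Suc (G xs + H xs). k) + G xs)"
    using assms by (intro pr_intros) auto
  then show ?thesis unfolding t by (simp add: prod_encode_def)
qed

lemma pr_prod_decode:
  assumes "pr_fun n G"
  shows "pr_fun n (\<lambda>xs. fst (prod_decode (G xs)))" "pr_fun n (\<lambda>xs. snd (prod_decode (G xs)))"
proof -
  have "primitive_rec_fun (\<lambda>z. \<Sum>a<Suc z. a * of_bool (\<exists>b<Suc z. prod_encode (a, b) = z))"
    "primitive_rec_fun (\<lambda>z. \<Sum>b<Suc z. b * of_bool (\<exists>a<Suc z. prod_encode (a, b) = z))"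
    unfolding primitive_rec_fun_iff by (intro pr_intros pr_prod_encode; simp)+
  moreover have
    "(\<Sum>a<Suc z. a * of_bool (\<exists>b<Suc z. prod_encode (a, b) = z)) = fst (prod_decode z)"
    "(\<Sum>b<Suc z. b * of_bool (\<exists>a<Suc z. prod_encode (a, b) = z)) = snd (prod_decode z)" for z
  proof -
    obtain a b where z: "z = prod_encode (a, b)" by (metis prod_decode_inverse surj_pair)
    have *: "a < Suc z" "b < Suc z" unfolding z
      using le_prod_encode_1 le_prod_encode_2 by (auto simp: less_Suc_eq_le)
    show "(\<Sum>a<Suc z. a * of_bool (\<exists>b<Suc z. prod_encode (a, b) = z)) = fst (prod_decode z)"
      using * by (subst sum_unique_index[of a]) (auto simp: z)
    show "(\<Sum>b<Suc z. b * of_bool (\<exists>a<Suc z. prod_encode (a, b) = z)) = snd (prod_decode z)"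
      using * by (subst sum_unique_index[of b]) (auto simp: z)
  qed
  ultimately have decode: "primitive_rec_fun (\<lambda>z. fst (prod_decode z))"
    "primitive_rec_fun (\<lambda>z. snd (prod_decode z))" by simp_all
  show "pr_fun n (\<lambda>xs. fst (prod_decode (G xs)))" by (rule pr_app[OF decode(1) assms])
  show "pr_fun n (\<lambda>xs. snd (prod_decode (G xs)))" by (rule pr_app[OF decode(2) assms])
qed

section \<open>A fast-growing hierarchy that dominates the primitive recursive functions\<close>

text \<open>The exponent \<open>n + 2\<close> and the argument \<open>Suc n\<close> are chosen so that
  \<open>hier j\<close> is exactly the time at which a simple stack machine finishes (see
  \<open>clock_step\<close>); since the exponent is at least \<open>2\<close>, level \<open>Suc j\<close> also
  absorbs two applications of level \<open>j\<close>.\<close>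

primrec hier :: "nat \<Rightarrow> nat \<Rightarrow> nat" where
  "hier 0 n = Suc n"
| "hier (Suc j) n = (hier j ^^ (n + 2)) (Suc n)"

lemma funpow_inflationary:
  fixes f :: "nat \<Rightarrow> nat"
  assumes "\<And>n. n < f n"
  shows "k + n \<le> (f ^^ k) n"
proof (induction k)
  case (Suc k)
  have "Suc (k + n) \<le> Suc ((f ^^ k) n)" using Suc by simp
  also have "\<dots> \<le> f ((f ^^ k) n)" using assms by (simp add: Suc_le_eq)
  finally show ?case by simp
qed simp

lemma funpow_mono_exponent:
  fixes f :: "nat \<Rightarrow> nat"
  assumes "\<And>n. n < f n" "k \<le> l"
  shows "(f ^^ k) n \<le> (f ^^ l) n"
proof -
  have "(f ^^ l) n = (f ^^ (l - k)) ((f ^^ k) n)"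
    using assms(2) by (metis comp_apply funpow_add le_add_diff_inverse2)
  then show ?thesis using funpow_inflationary[OF assms(1), of "l - k" "(f ^^ k) n"] by simp
qed

lemma hier_gt: "n < hier j n"
proof (induction j arbitrary: n)
  case (Suc j)
  show ?case using funpow_inflationary[of "hier j" "n + 2" "Suc n", OF Suc] by simp
qed simp

lemma hier_mono: "m \<le> n \<Longrightarrow> hier j m \<le> hier j n"
proof (induction j arbitrary: m n)
  case (Suc j)
  have "mono (hier j)" using Suc.IH by (simp add: mono_def)
  then have "(hier j ^^ (m + 2)) (Suc m) \<le> (hier j ^^ (m + 2)) (Suc n)"
    using Suc.prems by (intro funpow_mono) auto
  also have "\<dots> \<le> (hier j ^^ (n + 2)) (Suc n)"
    using Suc.prems by (intro funpow_mono_exponent hier_gt) auto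
  finally show ?case by simp
qed simp

lemma hier_hier_le: "hier j (hier j n) \<le> hier (Suc j) n"
proof -
  have "hier j (hier j n) \<le> (hier j ^^ 2) (Suc n)"
    by (simp add: numeral_2_eq_2 hier_mono)
  also have "\<dots> \<le> hier (Suc j) n"
    unfolding hier.simps by (intro funpow_mono_exponent hier_gt) simp
  finally show ?thesis .
qed

lemma hier_mono_level: "i \<le> j \<Longrightarrow> hier i n \<le> hier j n"
proof (induction rule: dec_induct)
  case (step j)
  then show ?case using hier_hier_le[of j n] hier_gt[of "hier j n" j] by linarith
qed simp

lemma pr_funpow:
  assumes "primitive_rec_fun f" "pr_fun n K" "pr_fun n G"
  shows "pr_fun n (\<lambda>xs. (f ^^ K xs) (G xs))"
proof -
  have "(f ^^ k) x = rec_nat x (\<lambda>_ r. f r) k" for k x by (induction k) auto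
  moreover have "pr_fun n (\<lambda>xs. rec_nat (G xs) (\<lambda>_ r. f r) (K xs))"
    by (intro pr_rec assms pr_app[OF assms(1)] pr_nth) auto
  ultimately show ?thesis by simp
qed

lemma primitive_rec_fun_hier: "primitive_rec_fun (hier j)"
proof (induction j)
  case 0
  then show ?case by (simp add: primitive_rec_fun_iff pr_Suc pr_nth)
next
  case (Suc j)
  then show ?case unfolding primitive_rec_fun_iff hier.simps 
    by (intro pr_funpow pr_intros; simp add: primitive_rec_fun_iff)
qed

text \<open>The bound is in terms of any upper bound \<open>s\<close> of the arguments; this form passes
  through composition without further estimates.\<close>

definition bounded_by_level :: "nat \<Rightarrow> (nat list \<Rightarrow> nat) \<Rightarrow> nat \<Rightarrow> bool" where
  "bounded_by_level n F j \<longleftrightarrow> (\<forall>xs s. length xs = n \<longrightarrow> (\<forall>x\<in>set xs. x \<le> s) \<longrightarrow> F xs \<le> hier j s)"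

lemma bounded_by_level_mono:
  "bounded_by_level n F i \<Longrightarrow> i \<le> j \<Longrightarrow> bounded_by_level n F j"
  unfolding bounded_by_level_def
  by (intro allI impI, rule le_trans[OF _ hier_mono_level]) blast+

lemma bounded_by_level_common:
  assumes "finite A" "\<And>F. F \<in> A \<Longrightarrow> \<exists>j. bounded_by_level n F j"
  shows "\<exists>j. \<forall>F\<in>A. bounded_by_level n F j"
proof -
  obtain j where j: "\<And>F. F \<in> A \<Longrightarrow> bounded_by_level n F (j F)" using assms(2) by metis
  have "bounded_by_level n F (Max (j ` A))" if "F \<in> A" for F
    using bounded_by_level_mono[OF j[OF that]] assms(1) that by simp
  then show ?thesis by blast
qed

text \<open>Composition costs two applications of one level. A recursion up to \<open>x\<close> costs
  \<open>Suc x\<close> applications to a bound \<open>s\<close> of all arguments, and \<open>x \<le>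
  s\<close>. One more level absorbs either.\<close>

lemma primitive_rec_bounded: "primitive_rec n F \<Longrightarrow> \<exists>j. bounded_by_level n F j"
proof (induction rule: primitive_rec.induct)
  case (zero n)
  then show ?case by (auto simp: bounded_by_level_def)
next
  case succ
  have "Suc (hd xs) \<le> hier 0 s" if "length xs = 1" "\<forall>x\<in>set xs. x \<le> s" for xs s
    using that by (cases xs) auto
  then show ?case unfolding bounded_by_level_def by blast
next
  case (proj i n)
  have "xs ! i \<le> hier 0 s" if "length xs = n" "\<forall>x\<in>set xs. x \<le> s" for xs s
    using that proj nth_mem[of i xs] by (auto simp: le_Suc_eq)
  then show ?case unfolding bounded_by_level_def by blast
next
  case (comp Gs F n)
  obtain i where i: "bounded_by_level (length Gs) F i" using comp by blast
  obtain j where j: "\<forall>G\<in>set Gs. bounded_by_level n G j"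
    using bounded_by_level_common[of "set Gs" n] comp by auto
  let ?k = "max i j"
  have "F (map (\<lambda>G. G xs) Gs) \<le> hier (Suc ?k) s"
    if "length xs = n" "\<forall>x\<in>set xs. x \<le> s" for xs s
  proof -
    have "\<forall>x\<in>set (map (\<lambda>G. G xs) Gs). x \<le> hier ?k s"
      using j that bounded_by_level_mono[of n _ j ?k] unfolding bounded_by_level_def by auto
    then have "F (map (\<lambda>G. G xs) Gs) \<le> hier ?k (hier ?k s)"
      using bounded_by_level_mono[OF i, of ?k] unfolding bounded_by_level_def by auto
    then show ?thesis using hier_hier_le le_trans by blast
  qed
  then show ?case unfolding bounded_by_level_def by blast
next
  case (recursion n F G)
  obtain i j where i: "bounded_by_level n F i" and j: "bounded_by_level (Suc (Suc n)) G j"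
    using recursion by blast
  let ?k = "max i j"
  have F: "F ys \<le> hier ?k s" if "length ys = n" "\<forall>y\<in>set ys. y \<le> s" for ys s
    using bounded_by_level_mono[OF i, of ?k] that unfolding bounded_by_level_def by auto
  have G: "G ys \<le> hier ?k s" if "length ys = Suc (Suc n)" "\<forall>y\<in>set ys. y \<le> s" for ys s
    using bounded_by_level_mono[OF j, of ?k] that unfolding bounded_by_level_def by auto
  have "rec_nat (F (tl xs)) (\<lambda>k r. G (k # r # tl xs)) (hd xs) \<le> hier (Suc ?k) s"
    if xs: "length xs = Suc n" "\<forall>x\<in>set xs. x \<le> s" for xs s
  proof -
    obtain x ys where [simp]: "xs = x # ys" using xs by (cases xs) auto
    have "rec_nat (F ys) (\<lambda>k r. G (k # r # ys)) m \<le> (hier ?k ^^ Suc m) s" if "m \<le> s" for m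
      using that
    proof (induction m)
      case 0
      then show ?case using xs F by simp
    next
      case (Suc m)
      let ?r = "rec_nat (F ys) (\<lambda>k r. G (k # r # ys)) m"
      have "s \<le> (hier ?k ^^ Suc m) s" using funpow_inflationary[of "hier ?k" "Suc m" s] hier_gt by fastforce
      then have "G (m # ?r # ys) \<le> hier ?k ((hier ?k ^^ Suc m) s)"
        using xs Suc by (intro G) (auto intro: le_trans)
      then show ?case by simp
    qed
    from this[of x] have "rec_nat (F ys) (\<lambda>k r. G (k # r # ys)) x \<le> (hier ?k ^^ Suc x) s"
      using xs by simp
    also have "\<dots> \<le> (hier ?k ^^ (s + 2)) s"
      using xs by (intro funpow_mono_exponent hier_gt) auto
    also have "\<dots> \<le> (hier ?k ^^ (s + 2)) (Suc s)"
      by (intro funpow_mono) (auto simp: mono_def hier_mono)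
    finally show ?thesis by simp
  qed
  then show ?case unfolding bounded_by_level_def by blast
qed

lemma primitive_rec_fun_dominated:
  assumes "primitive_rec_fun f" shows "\<exists>j. \<forall>n. f n \<le> hier j n"
proof -
  obtain F where F: "primitive_rec 1 F" "\<And>x. f x = F [x]"
    using assms unfolding primitive_rec_fun_def by blast
  then obtain j where "bounded_by_level 1 F j" using primitive_rec_bounded by blast
  then have "f n \<le> hier j n" for n unfolding bounded_by_level_def F(2) by auto
  then show ?thesis by blast
qed

section \<open>The graph of the hierarchy is primitive recursive\<close>

text \<open>The function \<open>(j, n) \<mapsto> hier j n\<close> is not primitive recursive, but its graph
  is. To see this, the hierarchy is computed by a machine whose state is a stack of levels. Time advances by
  one at each step, and the stack \<open>[j]\<close> started at time \<open>n\<close> becomes empty exactly at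
  time \<open>hier j n\<close>. Whether \<open>hier j n \<le> t\<close> can therefore be decided by running
  the machine up to time \<open>t\<close>.\<close>

fun clock_step :: "nat \<Rightarrow> nat list \<Rightarrow> nat list" where
  "clock_step s [] = []"
| "clock_step s (0 # L) = L"
| "clock_step s (Suc i # L) = replicate (s + 2) i @ L"

primrec finish_time :: "nat list \<Rightarrow> nat \<Rightarrow> nat" where
  "finish_time [] s = s"
| "finish_time (j # L) s = finish_time L (hier j s)"

primrec clock_run :: "nat list \<Rightarrow> nat \<Rightarrow> nat \<Rightarrow> nat list" where
  "clock_run L s 0 = L"
| "clock_run L s (Suc k) = clock_step (s + k) (clock_run L s k)"

lemma finish_time_replicate_append:
  "finish_time (replicate c i @ L) s = finish_time L ((hier i ^^ c) s)"
  by (induction c arbitrary: s) (simp_all add: funpow_swap1)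

lemma finish_time_step: "L \<noteq> [] \<Longrightarrow> finish_time (clock_step s L) (Suc s) = finish_time L s"
  by (induction s L rule: clock_step.induct) (simp_all add: finish_time_replicate_append del: replicate.simps)

lemma finish_time_ge: "s \<le> finish_time L s"
proof (induction L arbitrary: s)
  case (Cons j L)
  then show ?case using hier_gt[of s j] le_trans less_imp_le by (metis finish_time.simps(2))
qed simp

lemma finish_time_gt: "L \<noteq> [] \<Longrightarrow> s < finish_time L s"
  by (cases L) (auto intro: less_le_trans[OF hier_gt finish_time_ge])

text \<open>A step of a machine that still runs keeps the predicted finishing time. Once the stack is empty,
  the prediction is the current time; this is what the maximum records.\<close>

lemma finish_time_run: "finish_time (clock_run L s k) (s + k) = max (finish_time L s) (s + k)"
proof (induction k)
  case 0
  show ?case using finish_time_ge[of s L] by simp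
next
  case (Suc k)
  show ?case
  proof (cases "clock_run L s k = []")
    case True
    then show ?thesis using Suc by (auto simp: max_def split: if_splits)
  next
    case False
    then have "finish_time (clock_run L s (Suc k)) (s + Suc k) = finish_time (clock_run L s k) (s + k)"
      using finish_time_step by simp
    moreover have "s + k < finish_time (clock_run L s k) (s + k)" using False by (rule finish_time_gt)
    ultimately show ?thesis using Suc by (auto simp: max_def split: if_splits)
  qed
qed

lemma clock_run_empty_iff: "clock_run L s k = [] \<longleftrightarrow> finish_time L s \<le> s + k"
  using finish_time_run[of L s k] finish_time_gt[of "clock_run L s k" "s + k"]
  by (cases "clock_run L s k = []") (auto simp: max_def split: if_splits)

lemma hier_le_iff_clock: "hier j n \<le> t \<longleftrightarrow> n \<le> t \<and> clock_run [j] n (t - n) = []"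
  using hier_gt[of n j] by (auto simp: clock_run_empty_iff)

text \<open>The machine step on stacks encoded by \<open>list_encode\<close>: \<open>0\<close> is the empty
  stack, and the code of a nonempty stack is the successor of the code of the pair of its head and the code of
  its tail.\<close>

definition clock_step_code :: "nat \<Rightarrow> nat \<Rightarrow> nat" where
  "clock_step_code s e = (if e = 0 then 0
     else if fst (prod_decode (e - 1)) = 0 then snd (prod_decode (e - 1))
     else rec_nat (snd (prod_decode (e - 1)))
       (\<lambda>_ r. Suc (prod_encode (fst (prod_decode (e - 1)) - 1, r))) (s + 2))"

lemma clock_step_code: "list_encode (clock_step s L) = clock_step_code s (list_encode L)"
proof -
  have push: "rec_nat (list_encode L) (\<lambda>_ r. Suc (prod_encode (i, r))) c
      = list_encode (replicate c i @ L)" for i c L by (induction c) auto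
  show ?thesis
  proof (induction s L rule: clock_step.induct)
    case (3 s i L)
    show ?case using push[of L i "s + 2"] by (simp add: clock_step_code_def)
  qed (simp_all add: clock_step_code_def)
qed

lemma dec_hier_le:
  assumes "pr_fun n J" "pr_fun n G" "pr_fun n T"
  shows "dec n (\<lambda>xs. hier (J xs) (G xs) \<le> T xs)"
proof -
  have step: "pr_fun 2 (\<lambda>xs. clock_step_code (xs ! 0) (xs ! 1))"
    unfolding clock_step_code_def
    by (intro pr_intros pr_rec pr_prod_decode pr_prod_encode) auto
  have run: "list_encode (clock_run [j] s k)
      = rec_nat (Suc (prod_encode (j, 0))) (\<lambda>i r. clock_step_code (s + i) r) k" for j s k
    by (induction k) (simp_all add: clock_step_code)
  have empty: "clock_run [j] s k = [] \<longleftrightarrow> list_encode (clock_run [j] s k) = 0" for j s k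
    by (metis list_encode.simps(1) list_encode_eq)
  have "dec 3 (\<lambda>xs. xs ! 1 \<le> xs ! 2 \<and> clock_run [xs ! 0] (xs ! 1) (xs ! 2 - xs ! 1) = [])"
    unfolding empty run
    by (intro pr_intros pr_rec pr_prod_encode pr_app2[OF step]) auto
  then have "dec 3 (\<lambda>xs. hier (xs ! 0) (xs ! 1) \<le> xs ! 2)"
    unfolding hier_le_iff_clock .
  then show ?thesis by (rule pr_app3[OF _ assms])
qed

section \<open>Counting equivalence classes\<close>

definition is_class_rep :: "nat rel \<Rightarrow> nat \<Rightarrow> bool" where
  "is_class_rep R x \<longleftrightarrow> (\<forall>y<x. (y, x) \<notin> R)"

definition class_count :: "nat rel \<Rightarrow> nat \<Rightarrow> nat" where
  "class_count R n = card {x. x < n \<and> is_class_rep R x}"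

definition class_rep :: "nat rel \<Rightarrow> nat \<Rightarrow> nat" where
  "class_rep R x = (LEAST y. (y, x) \<in> R)"

lemma class_count_0 [simp]: "class_count R 0 = 0"
  by (simp add: class_count_def)

lemma class_count_Suc: "class_count R (Suc n) = class_count R n + of_bool (is_class_rep R n)"
proof -
  have "{x. x < Suc n \<and> is_class_rep R x} = (if is_class_rep R n then insert n {x. x < n \<and> is_class_rep R x} else {x. x < n \<and> is_class_rep R x})"
    by (auto simp: less_Suc_eq)
  then show ?thesis by (simp add: class_count_def)
qed

lemma class_count_eq_sum: "class_count R n = (\<Sum>x<n. of_bool (is_class_rep R x))"
  by (induction n) (simp_all add: class_count_Suc)

lemma mono_class_count: "mono (class_count R)"
  unfolding class_count_def by (intro monoI card_mono) auto

lemma class_count_less: "is_class_rep R x \<Longrightarrow> x < n \<Longrightarrow> class_count R x < class_count R n"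
  using monoD[OF mono_class_count[of R], of "Suc x" n] by (simp add: class_count_Suc)

lemma class_count_eq_imp_eq: "is_class_rep R x \<Longrightarrow> is_class_rep R y \<Longrightarrow> class_count R x = class_count R y \<Longrightarrow> x = y"
  using class_count_less by (metis less_irrefl nat_neq_iff)

lemma ex_class_rep_with_count: "k < class_count R n \<Longrightarrow> \<exists>x<n. is_class_rep R x \<and> class_count R x = k"
proof (induction n)
  case (Suc n)
  show ?case
  proof (cases "k < class_count R n")
    case True
    then show ?thesis using Suc.IH less_Suc_eq by blast
  next
    case False
    then have "is_class_rep R n" "class_count R n = k" using Suc.prems by (auto simp: class_count_Suc of_bool_def split: if_splits)
    then show ?thesis by blast
  qed
qed simp

context
  fixes R :: "nat rel"
  assumes equiv: "equiv UNIV R"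
begin

lemma related_refl: "(x, x) \<in> R"
  using equiv by (meson UNIV_I equivE refl_onD)

lemma related_sym: "(x, y) \<in> R \<Longrightarrow> (y, x) \<in> R"
  using equiv by (meson equivE symE)

lemma related_trans: "(x, y) \<in> R \<Longrightarrow> (y, z) \<in> R \<Longrightarrow> (x, z) \<in> R"
  using equiv by (meson equivE transE)

lemma class_rep_related: "(class_rep R x, x) \<in> R"
  unfolding class_rep_def by (rule LeastI) (rule related_refl)

lemma class_rep_le: "class_rep R x \<le> x"
  unfolding class_rep_def by (rule Least_le) (rule related_refl)

lemma is_class_rep_class_rep: "is_class_rep R (class_rep R x)"
  unfolding is_class_rep_def
proof (intro allI impI notI)
  fix y assume "y < class_rep R x" "(y, class_rep R x) \<in> R"
  then show False
    using related_trans[OF _ class_rep_related] not_less_Least[of y "\<lambda>y. (y, x) \<in> R"]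
    unfolding class_rep_def by blast
qed

lemma class_reps_related_eq: "is_class_rep R x \<Longrightarrow> is_class_rep R y \<Longrightarrow> (x, y) \<in> R \<Longrightarrow> x = y"
  unfolding is_class_rep_def using related_sym by (metis nat_neq_iff)

lemma class_rep_eq_iff: "class_rep R x = class_rep R y \<longleftrightarrow> (x, y) \<in> R"
proof
  assume "class_rep R x = class_rep R y"
  then show "(x, y) \<in> R"
    using related_trans[OF related_sym[OF class_rep_related[of x]], of y] class_rep_related[of y]
    by simp
next
  assume "(x, y) \<in> R"
  then have "(class_rep R x, class_rep R y) \<in> R"
    using related_trans related_sym class_rep_related by meson
  then show "class_rep R x = class_rep R y" by (intro class_reps_related_eq is_class_rep_class_rep)
qed

lemma bij_betw_class_reps_classes: "bij_betw (\<lambda>x. R `` {x}) {x. is_class_rep R x} (UNIV // R)"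
  unfolding bij_betw_def
proof
  show "inj_on (\<lambda>x. R `` {x}) {x. is_class_rep R x}"
    using class_reps_related_eq equiv by (auto simp: inj_on_def eq_equiv_class_iff)
  show "(\<lambda>x. R `` {x}) ` {x. is_class_rep R x} = UNIV // R"
  proof
    show "UNIV // R \<subseteq> (\<lambda>x. R `` {x}) ` {x. is_class_rep R x}"
    proof
      fix C assume "C \<in> UNIV // R"
      then obtain x where "C = R `` {x}" by (auto simp: quotient_def)
      then have "C = R `` {class_rep R x}"
        using equiv class_rep_related[of x] equiv_class_eq[OF equiv] by auto
      then show "C \<in> (\<lambda>x. R `` {x}) ` {x. is_class_rep R x}" using is_class_rep_class_rep by blast
    qed
  qed (auto simp: quotient_def)
qed

lemma infinite_classes_iff: "infinite (UNIV // R) \<longleftrightarrow> (\<forall>k. \<exists>n. k \<le> class_count R n)"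
proof -
  have "infinite {x. is_class_rep R x} \<longleftrightarrow> (\<forall>k. \<exists>n. k \<le> class_count R n)"
  proof
    assume inf: "infinite {x. is_class_rep R x}"
    show "\<forall>k. \<exists>n. k \<le> class_count R n"
    proof
      fix k
      obtain B where B: "finite B" "card B = k" "B \<subseteq> {x. is_class_rep R x}"
        using infinite_arbitrarily_large[OF inf] by blast
      have "B \<subseteq> {x. x < Suc (Max (insert 0 B)) \<and> is_class_rep R x}"
        using B by (auto simp: less_Suc_eq_le)
      then have "k \<le> class_count R (Suc (Max (insert 0 B)))"
        unfolding class_count_def B(2)[symmetric] by (intro card_mono) auto
      then show "\<exists>n. k \<le> class_count R n" by blast
    qed
  next
    assume unb: "\<forall>k. \<exists>n. k \<le> class_count R n"
    show "infinite {x. is_class_rep R x}"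
    proof
      assume fin: "finite {x. is_class_rep R x}"
      have "class_count R n \<le> card {x. is_class_rep R x}" for n
        unfolding class_count_def using fin by (intro card_mono) auto
      then show False using unb by (metis Suc_n_not_le_n le_trans)
    qed
  qed
  then show ?thesis using bij_betw_finite[OF bij_betw_class_reps_classes] by simp
qed

end

lemma primitive_rec_rel_iff: "primitive_rec_rel R \<longleftrightarrow> dec 2 (\<lambda>xs. (xs ! 0, xs ! 1) \<in> R)"
proof
  assume "primitive_rec_rel R"
  then obtain F where F: "primitive_rec 2 F" "\<And>x y. F [x, y] = of_bool ((x, y) \<in> R)"
    unfolding primitive_rec_rel_def by blast
  have "of_bool ((xs ! 0, xs ! 1) \<in> R) = F xs" if "length xs = 2" for xs
    using that by (auto simp: length_Suc_conv numeral_2_eq_2 F(2))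
  then show "dec 2 (\<lambda>xs. (xs ! 0, xs ! 1) \<in> R)" using F(1) unfolding pr_fun_def by blast
next
  assume "dec 2 (\<lambda>xs. (xs ! 0, xs ! 1) \<in> R)"
  then obtain F where F: "primitive_rec 2 F"
    "\<And>xs. length xs = 2 \<Longrightarrow> of_bool ((xs ! 0, xs ! 1) \<in> R) = F xs"
    unfolding pr_fun_def by blast
  then have "F [x, y] = of_bool ((x, y) \<in> R)" for x y using F(2)[of "[x, y]"] by simp
  then show "primitive_rec_rel R" unfolding primitive_rec_rel_def using F(1) by blast
qed

lemma primitive_rec_set_iff: "primitive_rec_set X \<longleftrightarrow> primitive_rec_fun (\<lambda>x. of_bool (x \<in> X))"
  unfolding primitive_rec_set_def primitive_rec_fun_def by metis

lemma dec_rel: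
  "primitive_rec_rel R \<Longrightarrow> pr_fun n G \<Longrightarrow> pr_fun n H \<Longrightarrow> dec n (\<lambda>xs. (G xs, H xs) \<in> R)"
  unfolding primitive_rec_rel_iff by (rule pr_app2[of "\<lambda>x y. of_bool ((x, y) \<in> R)"])

lemma dec_is_class_rep: "primitive_rec_rel R \<Longrightarrow> pr_fun n G \<Longrightarrow> dec n (\<lambda>xs. is_class_rep R (G xs))"
proof (rule pr_app[of "\<lambda>x. of_bool (is_class_rep R x)"])
  assume "primitive_rec_rel R"
  then show "primitive_rec_fun (\<lambda>x. of_bool (is_class_rep R x))"
    unfolding primitive_rec_fun_iff is_class_rep_def by (intro pr_intros dec_rel) auto
qed

lemma pr_class_count: "primitive_rec_rel R \<Longrightarrow> pr_fun n G \<Longrightarrow> pr_fun n (\<lambda>xs. class_count R (G xs))"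
proof (rule pr_app[of "class_count R"])
  assume "primitive_rec_rel R"
  then show "primitive_rec_fun (class_count R)"
    unfolding primitive_rec_fun_iff class_count_eq_sum by (intro pr_intros dec_is_class_rep) auto
qed

lemma pr_class_rep:
  assumes "equiv UNIV R" "primitive_rec_rel R" "pr_fun n G"
  shows "pr_fun n (\<lambda>xs. class_rep R (G xs))"
proof (rule pr_app[OF _ assms(3)])
  have "(\<Sum>y<Suc x. y * of_bool (is_class_rep R y \<and> (y, x) \<in> R)) = class_rep R x" for x
  proof (rule sum_unique_index)
    show "class_rep R x < Suc x" using class_rep_le[OF assms(1)] by (simp add: less_Suc_eq_le)
    show "is_class_rep R (class_rep R x) \<and> (class_rep R x, x) \<in> R"
      using is_class_rep_class_rep class_rep_related assms(1) by blast
    show "y = class_rep R x" if "is_class_rep R y \<and> (y, x) \<in> R" for y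
      using that is_class_rep_class_rep[OF assms(1)] class_rep_related[OF assms(1)]
        class_reps_related_eq[OF assms(1)] related_trans[OF assms(1)] related_sym[OF assms(1)] by metis
  qed
  moreover have "primitive_rec_fun (\<lambda>x. \<Sum>y<Suc x. y * of_bool (is_class_rep R y \<and> (y, x) \<in> R))"
    unfolding primitive_rec_fun_iff by (intro pr_intros dec_is_class_rep dec_rel assms(2)) auto
  ultimately show "primitive_rec_fun (class_rep R)" by simp
qed

section \<open>Degrees as growth rates\<close>

text \<open>The functions that will represent degrees. Such a function is read as the number of classes met
  before time \<open>n\<close>.\<close>

definition growth :: "(nat \<Rightarrow> nat) set" where
  "growth = {f. primitive_rec_fun f \<and> mono f \<and> (\<forall>k. \<exists>n. k \<le> f n)}"

text \<open>The rescaling acts on the argument only. Even \<open>f\<close> and \<open>f - 1\<close> are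
  inequivalent, unless \<open>f\<close> is equivalent to the identity.\<close>

definition slower :: "(nat \<Rightarrow> nat) \<Rightarrow> (nat \<Rightarrow> nat) \<Rightarrow> bool" where
  "slower f g \<longleftrightarrow> (\<exists>p. primitive_rec_fun p \<and> (\<forall>n. f n \<le> g (p n)))"

lemma class_count_growth: "punctual R \<Longrightarrow> class_count R \<in> growth"
  unfolding growth_def punctual_def
  using mono_class_count infinite_classes_iff pr_class_count[of R 1 "\<lambda>xs. xs ! 0"] pr_nth[of 0 1]
  by (auto simp: primitive_rec_fun_iff)

text \<open>A reduction sends inequivalent numbers to inequivalent numbers. The representatives below
  \<open>n\<close> thus yield as many classes of \<open>S\<close>, all of them met below a bound of the values
  of the reduction.\<close>

lemma pr_reducible_imp_slower_class_count:
  assumes "punctual R" "punctual S" "R \<le>\<^sub>p\<^sub>r S"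
  shows "slower (class_count R) (class_count S)"
proof -
  have eR: "equiv UNIV R" and eS: "equiv UNIV S" using assms unfolding punctual_def by auto
  obtain f where f: "primitive_rec_fun f" "\<And>x y. (x, y) \<in> R \<longleftrightarrow> (f x, f y) \<in> S"
    using assms(3) unfolding pr_reducible_def by blast
  define p where "p n = (\<Sum>x<n. Suc (f x))" for n
  have "primitive_rec_fun p"
    unfolding p_def primitive_rec_fun_iff by (intro pr_intros pr_app[OF f(1)]) auto
  moreover have "class_count R n \<le> class_count S (p n)" for n
    unfolding class_count_def
  proof (rule card_inj_on_le[where f = "\<lambda>x. class_rep S (f x)"])
    show "inj_on (\<lambda>x. class_rep S (f x)) {x. x < n \<and> is_class_rep R x}"
      using class_reps_related_eq[OF eR] by (auto simp: inj_on_def class_rep_eq_iff[OF eS] f(2))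
    have "f x < p n" if "x < n" for x
      using member_le_sum[of x "{..<n}" "\<lambda>x. Suc (f x)"] that by (simp add: p_def Suc_le_eq)
    then show "(\<lambda>x. class_rep S (f x)) ` {x. x < n \<and> is_class_rep R x} \<subseteq> {x. x < p n \<and> is_class_rep S x}"
      using is_class_rep_class_rep[OF eS] class_rep_le[OF eS] le_less_trans by blast
  qed simp
  ultimately show ?thesis unfolding slower_def by blast
qed

text \<open>Send the \<open>k\<close>-th class of \<open>R\<close> to the \<open>k\<close>-th class of
  \<open>S\<close>. For an element \<open>x\<close> of the former, the representative of the latter appears
  before \<open>p (Suc x)\<close>, so a bounded search finds it.\<close>

lemma slower_class_count_imp_pr_reducible:
  assumes "punctual R" "punctual S" "slower (class_count R) (class_count S)"
  shows "R \<le>\<^sub>p\<^sub>r S"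
proof -
  have eR: "equiv UNIV R" and eS: "equiv UNIV S" and pR: "primitive_rec_rel R"
    and pS: "primitive_rec_rel S" using assms unfolding punctual_def by auto
  obtain p where p: "primitive_rec_fun p" "\<And>n. class_count R n \<le> class_count S (p n)"
    using assms(3) unfolding slower_def by blast
  define f where
    "f x = (\<Sum>z<p (Suc x). z * of_bool (is_class_rep S z \<and> class_count S z = class_count R (class_rep R x)))" for x
  have f: "is_class_rep S (f x) \<and> class_count S (f x) = class_count R (class_rep R x)" for x
  proof -
    have "class_count R (class_rep R x) < class_count R (Suc x)"
      using class_count_less[OF is_class_rep_class_rep[OF eR]] class_rep_le[OF eR] by (simp add: less_Suc_eq_le)
    then obtain z where z: "z < p (Suc x)" "is_class_rep S z \<and> class_count S z = class_count R (class_rep R x)"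
      using ex_class_rep_with_count less_le_trans[OF _ p(2)] by metis
    have "f x = z" unfolding f_def using z class_count_eq_imp_eq[of S] by (intro sum_unique_index) auto
    then show ?thesis using z by simp
  qed
  have "primitive_rec_fun f"
    unfolding f_def primitive_rec_fun_iff
    by (intro pr_intros dec_is_class_rep pr_class_count pr_class_rep pr_app[OF p(1)] pR pS eR) auto
  moreover have "(x, y) \<in> R \<longleftrightarrow> (f x, f y) \<in> S" for x y
  proof -
    have "(x, y) \<in> R \<longleftrightarrow> class_count R (class_rep R x) = class_count R (class_rep R y)"
      using class_rep_eq_iff[OF eR] class_count_eq_imp_eq is_class_rep_class_rep[OF eR] by metis
    also have "\<dots> \<longleftrightarrow> f x = f y" using f class_count_eq_imp_eq by metis
    also have "\<dots> \<longleftrightarrow> (f x, f y) \<in> S"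
      using f class_reps_related_eq[OF eS] related_refl[OF eS] by metis
    finally show ?thesis .
  qed
  ultimately show ?thesis unfolding pr_reducible_def by blast
qed

lemma pr_reducible_iff_slower_class_count:
  "punctual R \<Longrightarrow> punctual S \<Longrightarrow> R \<le>\<^sub>p\<^sub>r S \<longleftrightarrow> slower (class_count R) (class_count S)"
  using pr_reducible_imp_slower_class_count slower_class_count_imp_pr_reducible by blast

text \<open>The count of classes grows by at most one at a time. A growth function may jump; \<open>smooth
  f\<close> is a delayed copy of \<open>f\<close> that climbs by single steps. The maximum with
  \<open>1\<close> accounts for the number \<open>0\<close>, which is always the first member of a
  class.\<close>

primrec smooth :: "(nat \<Rightarrow> nat) \<Rightarrow> nat \<Rightarrow> nat" where
  "smooth f 0 = 0"
| "smooth f (Suc n) = min (Suc (smooth f n)) (max 1 (f n))"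

text \<open>All times at which no new class appears are put into a single class, together with
  \<open>0\<close>, which makes the equivalence relation \<open>R_of (stalls f)\<close> meet its classes at
  the pace of \<open>smooth f\<close>.\<close>

definition stalls :: "(nat \<Rightarrow> nat) \<Rightarrow> nat set" where
  "stalls f = {x. x = 0 \<or> smooth f (Suc x) = smooth f x}"

lemma smooth_le_Suc: assumes "mono f" shows "smooth f n \<le> smooth f (Suc n)"
proof (cases n)
  case (Suc m)
  have "f m \<le> f n" using monoD[OF assms, of m n] Suc by simp
  then show ?thesis using Suc by (simp add: min_def max_def)
qed simp

lemma pr_smooth:
  assumes "primitive_rec_fun f" "pr_fun n G" shows "pr_fun n (\<lambda>xs. smooth f (G xs))"
proof -
  have "smooth f k = rec_nat 0 (\<lambda>k r. min (Suc r) (max 1 (f k))) k" for k by (induction k) auto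
  moreover have "pr_fun n (\<lambda>xs. rec_nat 0 (\<lambda>k r. min (Suc r) (max 1 (f k))) (G xs))"
    by (intro pr_rec pr_intros assms(2) pr_app[OF assms(1)]) auto
  ultimately show ?thesis by simp
qed

lemma equiv_R_of: "equiv UNIV (R_of Y)"
  by (auto simp: R_of_def equiv_def refl_on_def sym_def trans_def)

lemma class_count_R_of_stalls: assumes "mono f" shows "class_count (R_of (stalls f)) n = smooth f n"
proof (induction n)
  case (Suc n)
  have "is_class_rep (R_of (stalls f)) n \<longleftrightarrow> n = 0 \<or> n \<notin> stalls f"
    by (cases "n = 0") (auto simp: is_class_rep_def R_of_def stalls_def)
  also have "\<dots> \<longleftrightarrow> smooth f (Suc n) \<noteq> smooth f n" by (auto simp: stalls_def)
  finally have "is_class_rep (R_of (stalls f)) n \<longleftrightarrow> smooth f (Suc n) \<noteq> smooth f n" .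
  moreover have "smooth f (Suc n) = smooth f n \<or> smooth f (Suc n) = Suc (smooth f n)"
    using smooth_le_Suc[OF assms, of n] by auto
  ultimately show ?case using Suc unfolding class_count_Suc by auto
qed simp

text \<open>The constant \<open>c\<close> shifts past the finitely many places where \<open>f\<close> is
  \<open>0\<close> and the maximum with \<open>1\<close> in \<open>smooth\<close> matters.\<close>

lemma smooth_slower: assumes "f \<in> growth" shows "slower (smooth f) f"
proof -
  have f: "mono f" "\<exists>n. 1 \<le> f n" using assms unfolding growth_def by auto
  then obtain c where c: "1 \<le> f c" by blast
  have "smooth f n \<le> f (n + c)" for n
  proof (cases n)
    case (Suc m)
    have "f m \<le> f (n + c)" "f c \<le> f (n + c)" using monoD[OF f(1)] Suc by auto
    then show ?thesis using c Suc by auto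
  qed simp
  moreover have "primitive_rec_fun (\<lambda>n. n + c)"
    unfolding primitive_rec_fun_iff by (intro pr_intros) auto
  ultimately show ?thesis unfolding slower_def by blast
qed

lemma slower_smooth: assumes "f \<in> growth" shows "slower f (smooth f)"
proof -
  have f: "mono f" "primitive_rec_fun f" using assms unfolding growth_def by auto
  have "min k (f n) \<le> smooth f (n + k)" for n k
  proof (induction k)
    case (Suc k)
    have "f n \<le> f (n + k)" using monoD[OF f(1), of n "n + k"] by simp
    then show ?case using Suc by auto
  qed simp
  from this[of "f n" n for n] have "f n \<le> smooth f (n + f n)" for n by simp
  moreover have "primitive_rec_fun (\<lambda>n. n + f n)"
    unfolding primitive_rec_fun_iff by (intro pr_intros pr_app[OF f(2)]) auto
  ultimately show ?thesis unfolding slower_def by blast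
qed

lemma slower_refl: "slower f f"
proof -
  have "primitive_rec_fun (\<lambda>n. n)" unfolding primitive_rec_fun_iff by (intro pr_intros) auto
  then show ?thesis unfolding slower_def by blast
qed

lemma slower_trans: assumes "slower f g" "slower g h" shows "slower f h"
proof -
  obtain p q where pq: "primitive_rec_fun p" "\<And>n. f n \<le> g (p n)"
      "primitive_rec_fun q" "\<And>n. g n \<le> h (q n)"
    using assms unfolding slower_def by blast
  have "primitive_rec_fun (\<lambda>n. q (p n))"
    unfolding primitive_rec_fun_iff by (intro pr_intros pr_app[OF pq(3)] pr_app[OF pq(1)]) auto
  moreover have "f n \<le> h (q (p n))" for n using pq(2,4) le_trans by blast
  ultimately show ?thesis unfolding slower_def by blast
qed

lemma punctual_R_of_stalls: assumes "f \<in> growth"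
  shows "punctual (R_of (stalls f))" "primitive_rec_set (stalls f)"
proof -
  have f: "mono f" "primitive_rec_fun f" using assms unfolding growth_def by auto
  show "primitive_rec_set (stalls f)"
    unfolding primitive_rec_set_iff primitive_rec_fun_iff stalls_def mem_Collect_eq
    by (intro pr_intros pr_smooth f(2)) auto
  then have "dec n (\<lambda>xs. G xs \<in> stalls f)" if "pr_fun n G" for n G
    unfolding primitive_rec_set_iff using pr_app that by blast
  then have "primitive_rec_rel (R_of (stalls f))"
    unfolding primitive_rec_rel_iff R_of_def mem_Collect_eq prod.case
    by (intro pr_intros) (auto simp: pr_nth)
  moreover have "\<exists>n. k \<le> smooth f n" for k
  proof -
    obtain m where "k \<le> f m" using assms unfolding growth_def by auto
    then show ?thesis using slower_smooth[OF assms] le_trans unfolding slower_def by blast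
  qed
  ultimately show "punctual (R_of (stalls f))"
    unfolding punctual_def
    using equiv_R_of infinite_classes_iff[OF equiv_R_of] class_count_R_of_stalls[OF f(1)] by auto
qed

definition growth_deg :: "(nat \<Rightarrow> nat) \<Rightarrow> nat rel set" where
  "growth_deg f = deg (R_of (stalls f))"

lemma pr_reducible_stalls_iff:
  assumes "f \<in> growth" "punctual R"
  shows "R_of (stalls f) \<le>\<^sub>p\<^sub>r R \<longleftrightarrow> slower f (class_count R)" "R \<le>\<^sub>p\<^sub>r R_of (stalls f) \<longleftrightarrow> slower (class_count R) f"
proof -
  have "class_count (R_of (stalls f)) = smooth f"
    using class_count_R_of_stalls assms(1) unfolding growth_def by auto
  then show "R_of (stalls f) \<le>\<^sub>p\<^sub>r R \<longleftrightarrow> slower f (class_count R)" "R \<le>\<^sub>p\<^sub>r R_of (stalls f) \<longleftrightarrow> slower (class_count R) f"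
    using pr_reducible_iff_slower_class_count punctual_R_of_stalls(1)[OF assms(1)] assms(2)
      smooth_slower[OF assms(1)] slower_smooth[OF assms(1)] slower_trans by metis+
qed

lemma deg_eq_growth_deg: "punctual R \<Longrightarrow> deg R = growth_deg (class_count R)"
  unfolding growth_deg_def
  using deg_eq_iff punctual_R_of_stalls(1) class_count_growth pr_reducible_stalls_iff slower_refl
  unfolding pr_equivalent_def by blast

lemma deg_le_growth_deg_iff:
  assumes "f \<in> growth" "g \<in> growth"
  shows "deg_le (growth_deg f) (growth_deg g) \<longleftrightarrow> slower f g"
proof -
  let ?S = "R_of (stalls g)"
  have S: "punctual ?S" using punctual_R_of_stalls(1) assms(2) .
  have "deg_le (growth_deg f) (growth_deg g) \<longleftrightarrow> slower f (class_count ?S)"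
    unfolding growth_deg_def
    using deg_le_deg_iff S punctual_R_of_stalls(1) assms(1) pr_reducible_stalls_iff(1) by blast
  also have "\<dots> \<longleftrightarrow> slower f g"
    using pr_reducible_stalls_iff[OF assms(2) S] pr_reducible_refl slower_trans by blast
  finally show ?thesis .
qed

lemma Peq_eq_growth_deg: "Peq = growth_deg ` growth"
  unfolding Peq_def
  using deg_eq_growth_deg class_count_growth punctual_R_of_stalls(1) growth_deg_def by auto

lemma lowercone_eq_growth_deg:
  assumes "punctual R"
  shows "lowercone R = growth_deg ` {f \<in> growth. slower f (class_count R)}"
proof
  show "lowercone R \<subseteq> growth_deg ` {f \<in> growth. slower f (class_count R)}"
    unfolding lowercone_def
    using deg_eq_growth_deg class_count_growth pr_reducible_iff_slower_class_count assms by auto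
  show "growth_deg ` {f \<in> growth. slower f (class_count R)} \<subseteq> lowercone R"
    unfolding lowercone_def growth_deg_def
    using punctual_R_of_stalls pr_reducible_stalls_iff(1) assms by blast
qed

section \<open>Growth rates as a lattice\<close>

text \<open>Every comparison of growth rates is witnessed by a level of the hierarchy, and then by all higher
  levels. Finitely many comparisons therefore have a common witness, which is moreover monotone.\<close>

lemma slower_hier:
  assumes "slower f g" "mono g"
  shows "\<exists>j. \<forall>i\<ge>j. \<forall>n. f n \<le> g (hier i n)"
proof -
  obtain p where p: "primitive_rec_fun p" "\<And>n. f n \<le> g (p n)"
    using assms(1) unfolding slower_def by blast
  obtain j where j: "\<And>n. p n \<le> hier j n" using primitive_rec_fun_dominated[OF p(1)] by blast
  have "f n \<le> g (hier i n)" if "j \<le> i" for i n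
    using p(2)[of n] monoD[OF assms(2), of "p n" "hier i n"] j[of n] hier_mono_level[OF that, of n]
    by linarith
  then show ?thesis by (intro exI[of _ j] allI impI)
qed

lemma hier_slower: "(\<And>n. f n \<le> g (hier j n)) \<Longrightarrow> slower f g"
  unfolding slower_def by (intro exI[of _ "hier j"]) (simp add: primitive_rec_fun_hier)

lemma slower_pointwise: "(\<And>n. f n \<le> g n) \<Longrightarrow> slower f g"
  by (auto simp: slower_def primitive_rec_fun_iff intro!: exI[of _ "\<lambda>n. n"] pr_nth)

lemma growthD:
  assumes "f \<in> growth"
  shows "primitive_rec_fun f" "mono f" "\<exists>n. k \<le> f n"
  using assms unfolding growth_def by auto

lemma id_growth: "(\<lambda>n. n) \<in> growth"
  unfolding growth_def by (auto simp: primitive_rec_fun_iff mono_def pr_nth)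

lemma slower_id: "f \<in> growth \<Longrightarrow> slower f (\<lambda>n. n)"
  unfolding slower_def using growthD(1) by blast

lemma growth_max:
  assumes "f \<in> growth" "g \<in> growth" shows "(\<lambda>n. max (f n) (g n)) \<in> growth"
  unfolding growth_def mem_Collect_eq
proof (intro conjI allI)
  show "primitive_rec_fun (\<lambda>n. max (f n) (g n))"
    unfolding primitive_rec_fun_iff
    by (intro pr_intros pr_app[OF growthD(1)[OF assms(1)]] pr_app[OF growthD(1)[OF assms(2)]]) auto
  show "mono (\<lambda>n. max (f n) (g n))"
    using growthD(2)[OF assms(1)] growthD(2)[OF assms(2)] unfolding mono_def by (meson max.mono)
  show "\<exists>n. k \<le> max (f n) (g n)" for k
    using growthD(3)[OF assms(1), of k] max.coboundedI1 by blast
qed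

lemma growth_min:
  assumes "f \<in> growth" "g \<in> growth" shows "(\<lambda>n. min (f n) (g n)) \<in> growth"
  unfolding growth_def mem_Collect_eq
proof (intro conjI allI)
  show "primitive_rec_fun (\<lambda>n. min (f n) (g n))"
    unfolding primitive_rec_fun_iff
    by (intro pr_intros pr_app[OF growthD(1)[OF assms(1)]] pr_app[OF growthD(1)[OF assms(2)]]) auto
  show "mono (\<lambda>n. min (f n) (g n))"
    using growthD(2)[OF assms(1)] growthD(2)[OF assms(2)] unfolding mono_def by (meson min.mono)
  show "\<exists>n. k \<le> min (f n) (g n)" for k
  proof -
    obtain a b where ab: "k \<le> f a" "k \<le> g b" using growthD(3) assms by metis
    have "k \<le> f (max a b)" "k \<le> g (max a b)"
      using ab monoD[OF growthD(2)[OF assms(1)], of a "max a b"]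
        monoD[OF growthD(2)[OF assms(2)], of b "max a b"] by auto
    then show ?thesis by auto
  qed
qed

lemma slower_min:
  assumes "slower l f" "slower l g" "mono f" "mono g"
  shows "slower l (\<lambda>n. min (f n) (g n))"
proof -
  obtain i j where "\<forall>k\<ge>i. \<forall>n. l n \<le> f (hier k n)" "\<forall>k\<ge>j. \<forall>n. l n \<le> g (hier k n)"
    using slower_hier assms by metis
  then have "l n \<le> min (f (hier (max i j) n)) (g (hier (max i j) n))" for n by simp
  then show ?thesis by (rule hier_slower)
qed

lemma max_slower:
  assumes "slower f u" "slower g u" "mono u"
  shows "slower (\<lambda>n. max (f n) (g n)) u"
proof -
  obtain i j where "\<forall>k\<ge>i. \<forall>n. f n \<le> u (hier k n)" "\<forall>k\<ge>j. \<forall>n. g n \<le> u (hier k n)"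
    using slower_hier assms by metis
  then have "max (f n) (g n) \<le> u (hier (max i j) n)" for n by simp
  then show ?thesis by (rule hier_slower)
qed

section \<open>An order property that separates the two orders\<close>

definition joins_to_top :: "'a set \<Rightarrow> ('a \<Rightarrow> 'a \<Rightarrow> bool) \<Rightarrow> 'a \<Rightarrow> 'a \<Rightarrow> bool" where
  "joins_to_top D le a b \<longleftrightarrow> (\<forall>u\<in>D. le a u \<longrightarrow> le b u \<longrightarrow> (\<forall>d\<in>D. le d u))"

text \<open>Intuitively, at each place where the top exceeds \<open>f\<close>, one of \<open>a\<close> and
  \<open>b\<close> alone can do all the work of reaching the top: this work can be divided between
  \<open>c\<close> and \<open>d\<close> without overlap above \<open>f\<close>.\<close>

definition splits_covers :: "'a set \<Rightarrow> ('a \<Rightarrow> 'a \<Rightarrow> bool) \<Rightarrow> bool" where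
  "splits_covers D le \<longleftrightarrow> (\<exists>f\<in>D. (\<exists>d\<in>D. \<not> le d f) \<and>
     (\<forall>a\<in>D. \<forall>b\<in>D. le f a \<longrightarrow> le f b \<longrightarrow> joins_to_top D le a b \<longrightarrow>
       (\<exists>c\<in>D. \<exists>d\<in>D. le c a \<and> le d b \<and> joins_to_top D le c d \<and>
          (\<forall>l\<in>D. le l c \<longrightarrow> le l d \<longrightarrow> le l f))))"

lemma joins_to_top_max:
  assumes "joins_to_top D slower a b" "(\<lambda>n. max (a n) (b n)) \<in> D" "d \<in> D"
  shows "slower d (\<lambda>n. max (a n) (b n))"
proof -
  have "slower a (\<lambda>n. max (a n) (b n))" "slower b (\<lambda>n. max (a n) (b n))"
    by (rule slower_pointwise, simp)+
  then show ?thesis using assms unfolding joins_to_top_def by blast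
qed

lemma splits_covers_image:
  assumes "\<And>x y. x \<in> A \<Longrightarrow> y \<in> A \<Longrightarrow> le' (h x) (h y) \<longleftrightarrow> le x y"
  shows "splits_covers (h ` A) le' \<longleftrightarrow> splits_covers A le"
  unfolding splits_covers_def joins_to_top_def ball_simps bex_simps
  using assms by (simp cong: ball_cong bex_cong)

section \<open>Pauses of a growth rate\<close>

text \<open>A pause of \<open>f\<close> is a maximal interval on which \<open>f\<close> is constant. Its left
  end is known as soon as it begins, while its length is not.\<close>

primrec pause_start :: "(nat \<Rightarrow> nat) \<Rightarrow> nat \<Rightarrow> nat" where
  "pause_start f 0 = 0"
| "pause_start f (Suc n) = (if f (Suc n) = f n then pause_start f n else Suc n)"

lemma pr_pause_start:
  assumes "primitive_rec_fun f" "pr_fun n G" shows "pr_fun n (\<lambda>xs. pause_start f (G xs))"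
proof -
  have "pause_start f k = rec_nat 0 (\<lambda>k r. if f (Suc k) = f k then r else Suc k) k" for k
    by (induction k) auto
  moreover have "pr_fun n (\<lambda>xs. rec_nat 0 (\<lambda>k r. if f (Suc k) = f k then r else Suc k) (G xs))"
    by (intro pr_rec pr_intros assms(2) pr_app[OF assms(1)]) auto
  ultimately show ?thesis by simp
qed

lemma pause_start_le: "pause_start f n \<le> n"
  by (induction n) auto

lemma f_pause_start: "f (pause_start f n) = f n"
  by (induction n) auto

lemma mono_pause_start: "mono (pause_start f)"
  unfolding mono_iff_le_Suc
proof
  show "pause_start f n \<le> pause_start f (Suc n)" for n
    using pause_start_le[of f n] by auto
qed

lemma f_eq_Suc_of_pause:
  assumes "mono f" "m \<le> k" "Suc k \<le> n" "f m = f n"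
  shows "f (Suc k) = f k"
  using monoD[OF assms(1), of m k] monoD[OF assms(1), of k "Suc k"]
    monoD[OF assms(1), of "Suc k" n] assms by simp

lemma pause_start_eq:
  assumes "mono f" "m \<le> n" "f m = f n" shows "pause_start f m = pause_start f n"
proof -
  have "k \<le> n \<Longrightarrow> pause_start f k = pause_start f m" if "m \<le> k" for k
    using that
  proof (induction rule: dec_induct)
    case (step k)
    then show ?case using f_eq_Suc_of_pause[OF assms(1), of m k n] assms(3) by simp
  qed simp
  from this[OF assms(2)] show ?thesis by simp
qed

section \<open>Proper cones split covers\<close>

text \<open>The element to choose is \<open>g - 1\<close>. It is strictly below \<open>g\<close>: if \<open>g
  n \<le> g (p n) - 1\<close>, then every application of \<open>p\<close> gains at least one class, and
  iterating \<open>p\<close> bounds the identity by \<open>g\<close>. Between \<open>g - 1\<close> and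
  \<open>g\<close> there is room for just one unit on each pause of \<open>g\<close>. If \<open>a\<close> and
  \<open>b\<close> join to \<open>g\<close>, then shortly after the start of each pause one of the two has
  gained this unit. Which one can be computed from the start of the pause, and this decision assigns the whole
  pause to \<open>c\<close> or to \<open>d\<close>.\<close>

lemma splits_covers_cone:
  assumes g: "g \<in> growth" and not_top: "\<not> slower (\<lambda>n. n) g"
  shows "splits_covers {f \<in> growth. slower f g} slower"
proof -
  let ?D = "{f \<in> growth. slower f g}"
  note gD = growthD[OF g]
  have gD_in: "g \<in> ?D" using g slower_refl by blast
  define f where "f n = g n - 1" for n
  have f_growth: "f \<in> growth"
    unfolding growth_def mem_Collect_eq
  proof (intro conjI allI)
    show "primitive_rec_fun f"
      unfolding f_def primitive_rec_fun_iff by (intro pr_intros pr_app[OF gD(1)]) auto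
    show "mono f" using gD(2) unfolding mono_def f_def by (meson diff_le_mono)
    show "\<exists>n. k \<le> f n" for k
    proof -
      obtain n where "Suc k \<le> g n" using gD(3) by blast
      then have "k \<le> f n" by (simp add: f_def)
      then show ?thesis by blast
    qed
  qed
  have f_g: "slower f g" by (rule slower_pointwise) (simp add: f_def)
  have "\<not> slower g f"
  proof
    assume "slower g f"
    then obtain p where p: "primitive_rec_fun p" "\<And>n. g n \<le> f (p n)" unfolding slower_def by blast
    obtain m where m: "1 \<le> g m" using gD(3) by blast
    have "Suc k \<le> g ((p ^^ k) m)" for k
    proof (induction k)
      case (Suc k)
      then show ?case using p(2)[of "(p ^^ k) m"] by (simp add: f_def)
    qed (use m in simp)
    then have "k \<le> g ((p ^^ k) m)" for k using Suc_leD by blast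
    moreover have "primitive_rec_fun (\<lambda>k. (p ^^ k) m)"
      unfolding primitive_rec_fun_iff by (intro pr_funpow p(1) pr_intros) auto
    ultimately show False using not_top unfolding slower_def by blast
  qed
  moreover have "\<exists>c\<in>?D. \<exists>d\<in>?D. slower c a \<and> slower d b \<and> joins_to_top ?D slower c d \<and>
      (\<forall>l\<in>?D. slower l c \<longrightarrow> slower l d \<longrightarrow> slower l f)"
    if a: "a \<in> ?D" and b: "b \<in> ?D" and fa: "slower f a" and fb: "slower f b"
      and top: "joins_to_top ?D slower a b" for a b
  proof -
    have ab: "a \<in> growth" "b \<in> growth" "mono a" "mono b" "slower a g" "slower b g"
      using a b growthD(2) by auto
    have "(\<lambda>n. max (a n) (b n)) \<in> ?D"
      using growth_max ab max_slower gD(2) by blast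
    then have "slower g (\<lambda>n. max (a n) (b n))" by (rule joins_to_top_max[OF top _ gD_in])
    then obtain j1 where j1: "\<forall>i\<ge>j1. \<forall>n. g n \<le> max (a (hier i n)) (b (hier i n))"
      using slower_hier growthD(2)[OF growth_max[OF ab(1,2)]] by meson
    obtain j2 where j2: "\<forall>i\<ge>j2. \<forall>n. f n \<le> a (hier i n)" using slower_hier fa ab by blast
    obtain j3 where j3: "\<forall>i\<ge>j3. \<forall>n. f n \<le> b (hier i n)" using slower_hier fb ab by blast
    define j where "j = max j1 (max j2 j3)"
    have j: "g n \<le> max (a (hier j n)) (b (hier j n))" "f n \<le> a (hier j n)" "f n \<le> b (hier j n)" for n
      using j1 j2 j3 by (auto simp: j_def)
    define s where "s n = pause_start g n" for n
    \<comment> \<open>The predicate is evaluated at the start of the pause, so it is constant on each pause; \<open>a\<close> has gained the unit in time.\<close>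
    define P where "P n \<longleftrightarrow> g n \<le> a (hier j (s n))" for n
    have P_pause: "P m = P n" if "m \<le> n" "g m = g n" for m n
      using that pause_start_eq[OF gD(2) that] by (simp add: P_def s_def)
    have decP: "dec n (\<lambda>xs. P (G xs))" if "pr_fun n G" for n G
      unfolding P_def s_def
      by (intro pr_intros pr_app[OF gD(1)] pr_app[OF growthD(1)[OF ab(1)]]
          pr_app[OF primitive_rec_fun_hier] pr_pause_start gD(1) that)
    define c where "c Q n = (if Q n then g n else f n)" for Q :: "nat \<Rightarrow> bool" and n
    have c_growth: "c Q \<in> growth"
      if Q: "dec 1 (\<lambda>xs. Q (xs ! 0))" "\<And>m n. m \<le> n \<Longrightarrow> g m = g n \<Longrightarrow> Q m = Q n" for Q
      unfolding growth_def mem_Collect_eq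
    proof (intro conjI allI)
      show "primitive_rec_fun (c Q)"
        unfolding primitive_rec_fun_iff c_def
        by (intro pr_intros Q(1) pr_app[OF gD(1)] pr_app[OF growthD(1)[OF f_growth]]) auto
      show "mono (c Q)"
      proof (rule monoI)
        fix m n :: nat assume mn: "m \<le> n"
        then have "g m \<le> g n" using monoD[OF gD(2)] by blast
        then consider "g m = g n" | "Suc (g m) \<le> g n" by linarith
        then show "c Q m \<le> c Q n"
          by cases (use Q(2)[OF mn] in \<open>auto simp: c_def f_def\<close>)
      qed
      show "\<exists>n. k \<le> c Q n" for k
        using growthD(3)[OF f_growth, of k] by (force simp: c_def f_def)
    qed
    have c_g: "slower (c Q) g" for Q by (rule slower_pointwise) (simp add: c_def f_def)
    let ?c = "c P" and ?d = "c (\<lambda>n. \<not> P n)"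
    have "?c \<in> ?D" "?d \<in> ?D"
      using c_g by (auto intro!: c_growth decP dec_not pr_nth dest: P_pause)
    moreover have "slower ?c a"
    proof (rule hier_slower)
      fix n
      have "a (hier j (s n)) \<le> a (hier j n)"
        unfolding s_def by (intro monoD[OF ab(3)] hier_mono pause_start_le)
      then show "?c n \<le> a (hier j n)" using j(2)[of n] by (auto simp: c_def P_def)
    qed
    moreover have "slower ?d b"
    proof (rule hier_slower)
      fix n
      have "b (hier j (s n)) \<le> b (hier j n)"
        unfolding s_def by (intro monoD[OF ab(4)] hier_mono pause_start_le)
      moreover have "g (s n) = g n" by (simp add: s_def f_pause_start)
      ultimately show "?d n \<le> b (hier j n)"
        using j(1)[of "s n"] j(3)[of n] by (auto simp: c_def P_def)
    qed
    moreover have "joins_to_top ?D slower ?c ?d"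
      unfolding joins_to_top_def
    proof (intro ballI impI)
      fix u e assume u: "u \<in> ?D" "slower ?c u" "slower ?d u" and e: "e \<in> ?D"
      have "slower (\<lambda>n. max (?c n) (?d n)) u" using max_slower u growthD(2) by blast
      moreover have "max (?c n) (?d n) = g n" for n by (auto simp: c_def f_def)
      ultimately show "slower e u" using e slower_trans by auto
    qed
    moreover have "slower l f" if "l \<in> ?D" "slower l ?c" "slower l ?d" for l
    proof -
      have "slower l (\<lambda>n. min (?c n) (?d n))"
        using slower_min that growthD(2) \<open>?c \<in> ?D\<close> \<open>?d \<in> ?D\<close> by blast
      moreover have "min (?c n) (?d n) = f n" for n by (auto simp: c_def f_def)
      ultimately show ?thesis by simp
    qed
    ultimately show ?thesis by blast
  qed
  ultimately show ?thesis unfolding splits_covers_def using f_growth f_g gD_in by blast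
qed

section \<open>The whole order does not split covers\<close>

text \<open>The number of pauses of \<open>f\<close> up to \<open>n\<close> that were long when measured
  against their own number: a pause that starts at \<open>a\<close> while the count is \<open>k\<close> is
  counted if it lasts until \<open>hier (Suc k) a\<close>. The count changes only at the end of a
  pause.\<close>

primrec level :: "(nat \<Rightarrow> nat) \<Rightarrow> nat \<Rightarrow> nat" where
  "level f 0 = 0"
| "level f (Suc n) =
    (if f (Suc n) \<noteq> f n \<and> hier (Suc (level f n)) (pause_start f n) \<le> n
     then Suc (level f n) else level f n)"

lemma pr_level:
  assumes "primitive_rec_fun f" "pr_fun n G" shows "pr_fun n (\<lambda>xs. level f (G xs))"
proof -
  have "level f k = rec_nat 0 (\<lambda>k r. if f (Suc k) \<noteq> f k \<and> hier (Suc r) (pause_start f k) \<le> k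
      then Suc r else r) k" for k
    by (induction k) auto
  moreover have "pr_fun n (\<lambda>xs. rec_nat 0 (\<lambda>k r.
      if f (Suc k) \<noteq> f k \<and> hier (Suc r) (pause_start f k) \<le> k then Suc r else r) (G xs))"
    by (intro pr_rec pr_intros dec_hier_le pr_pause_start assms pr_app[OF assms(1)]) auto
  ultimately show ?thesis by simp
qed

lemma mono_level: "mono (level f)"
  by (simp add: mono_iff_le_Suc)

lemma level_eq:
  assumes "mono f" "m \<le> n" "f m = f n" shows "level f m = level f n"
proof -
  have "k \<le> n \<Longrightarrow> level f k = level f m" if "m \<le> k" for k
    using that
  proof (induction rule: dec_induct)
    case (step k)
    then show ?case using f_eq_Suc_of_pause[OF assms(1), of m k n] assms(3) by simp
  qed simp
  from this[OF assms(2)] show ?thesis by simp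
qed

text \<open>Otherwise \<open>f\<close> gains a class whenever \<open>hier j\<close> is applied, and iterating
  \<open>hier j\<close> bounds the identity by \<open>f\<close>.\<close>

lemma long_pause:
  assumes "mono f" "\<not> slower (\<lambda>n. n) f"
  shows "\<exists>n\<ge>N. f (hier j n) = f n"
proof (rule ccontr)
  assume "\<not> ?thesis"
  then have less: "f n < f (hier j n)" if "N \<le> n" for n
    using that monoD[OF assms(1), of n "hier j n"] hier_gt[of n j] by (metis le_neq_implies_less less_imp_le)
  have "k \<le> f ((hier j ^^ k) N)" for k
  proof (induction k)
    case (Suc k)
    have "N \<le> (hier j ^^ k) N" using funpow_inflationary[of "hier j" k N, OF hier_gt] by simp
    then show ?case using Suc less[of "(hier j ^^ k) N"] by simp
  qed simp
  moreover have "primitive_rec_fun (\<lambda>k. (hier j ^^ k) N)"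
    unfolding primitive_rec_fun_iff by (intro pr_funpow primitive_rec_fun_hier pr_intros) auto
  ultimately show False using assms(2) unfolding slower_def by blast
qed

lemma pause_end:
  assumes "f \<in> growth" shows "\<exists>t\<ge>n. f t = f n \<and> f (Suc t) \<noteq> f t"
proof -
  define t where "t = (LEAST t. n \<le> t \<and> f (Suc t) \<noteq> f n)"
  obtain m where m: "Suc (f n) \<le> f m" using growthD(3)[OF assms] by blast
  have "f m \<le> f (Suc (max m n))" using monoD[OF growthD(2)[OF assms], of m "Suc (max m n)"] by simp
  then have "n \<le> max m n \<and> f (Suc (max m n)) \<noteq> f n" using m by auto
  then have t: "n \<le> t \<and> f (Suc t) \<noteq> f n" unfolding t_def by (rule LeastI)
  have "f t = f n"
  proof (cases "t = n")
    case False
    then obtain k where k: "t = Suc k" "n \<le> k" using t by (cases t) auto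
    then show ?thesis using not_less_Least[of k "\<lambda>t. n \<le> t \<and> f (Suc t) \<noteq> f n"] unfolding t_def by auto
  qed simp
  then show ?thesis using t by auto
qed

text \<open>While the count stays at \<open>k\<close>, any pause that lasts from some \<open>n\<close> to
  \<open>hier (Suc k) n\<close> increases it, and such a pause exists arbitrarily late.\<close>

lemma level_increase:
  assumes "f \<in> growth" "\<not> slower (\<lambda>n. n) f" "level f N = k"
  shows "\<exists>t\<ge>N. level f t = k \<and> f (Suc t) \<noteq> f t \<and> hier (Suc k) (pause_start f t) \<le> t"
proof (rule ccontr)
  assume neg: "\<not> ?thesis"
  have const: "level f t = k" if "N \<le> t" for t
    using that by (induction rule: dec_induct) (use neg assms(3) in auto)
  obtain n where n: "N \<le> n" "f (hier (Suc k) n) = f n"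
    using long_pause growthD(2) assms by blast
  let ?m = "hier (Suc k) n"
  obtain t where t: "?m \<le> t" "f t = f ?m" "f (Suc t) \<noteq> f t" using pause_end[OF assms(1)] by blast
  have "n \<le> t" using t(1) hier_gt[of n "Suc k"] by linarith
  then have "pause_start f t = pause_start f n"
    using pause_start_eq[OF growthD(2)[OF assms(1)], of n t] t n by simp
  then have "hier (Suc k) (pause_start f t) \<le> t"
    using hier_mono[OF pause_start_le, of "Suc k" f n] t(1) by (metis le_trans)
  then show False using neg const t(3) \<open>n \<le> t\<close> n(1) by (meson le_trans)
qed

lemma pause_at_level:
  assumes "f \<in> growth" "\<not> slower (\<lambda>n. n) f"
  shows "\<exists>t. level f t = k \<and> hier (Suc k) (pause_start f t) \<le> t"
proof -
  have "\<exists>N. level f N = k"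
  proof (induction k)
    case 0
    have "level f 0 = 0" by simp
    then show ?case by blast
  next
    case (Suc k)
    then obtain t where "level f t = k" "f (Suc t) \<noteq> f t" "hier (Suc k) (pause_start f t) \<le> t"
      using level_increase assms by metis
    then have "level f (Suc t) = Suc k" by simp
    then show ?case by blast
  qed
  then show ?thesis using level_increase assms by blast
qed

text \<open>A point that is far beyond the start of the pause and also far before its end, for the pauses
  counted by \<open>level\<close>: as the level tends to infinity, either distance eventually exceeds any
  given primitive recursive function. It depends only on the past of the pause, so that it is known when it is
  reached.\<close>

definition midpoint :: "(nat \<Rightarrow> nat) \<Rightarrow> nat \<Rightarrow> nat" where
  "midpoint f n = hier (level f n) (pause_start f n)"

text \<open>Two growth rates with maximum \<open>n\<close>. Up to the midpoint of a pause of \<open>f\<close>,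
  \<open>early f\<close> does the work and \<open>late f\<close> rests; after it, the roles are
  exchanged.\<close>

definition early :: "(nat \<Rightarrow> nat) \<Rightarrow> nat \<Rightarrow> nat" where
  "early f n = min n (midpoint f n)"

definition late :: "(nat \<Rightarrow> nat) \<Rightarrow> nat \<Rightarrow> nat" where
  "late f n = (if n < midpoint f n then pause_start f n else n)"

lemma mono_midpoint: "mono (midpoint f)"
proof (rule monoI)
  fix m n :: nat assume "m \<le> n"
  then have "hier (level f m) (pause_start f m) \<le> hier (level f m) (pause_start f n)"
    "level f m \<le> level f n"
    using monoD[OF mono_pause_start] monoD[OF mono_level] by (auto intro: hier_mono)
  then show "midpoint f m \<le> midpoint f n"
    unfolding midpoint_def using hier_mono_level le_trans by blast
qed

lemma midpoint_eq: "mono f \<Longrightarrow> m \<le> n \<Longrightarrow> f m = f n \<Longrightarrow> midpoint f m = midpoint f n"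
  unfolding midpoint_def using pause_start_eq level_eq by metis

lemma dec_less_midpoint:
  assumes "primitive_rec_fun f" "pr_fun n G" "pr_fun n H"
  shows "dec n (\<lambda>xs. G xs < midpoint f (H xs))"
  unfolding midpoint_def not_le[symmetric]
  by (intro dec_not dec_hier_le pr_level pr_pause_start assms)

text \<open>Writes the minimum with the midpoint as a bounded sum, since the midpoint itself need not be a
  primitive recursive function.\<close>

lemma min_eq_sum: "min n m = (\<Sum>k<n. of_bool (k < m))" for n m :: nat
  by (induction n) auto

lemma early_growth: assumes "f \<in> growth" shows "early f \<in> growth"
  unfolding growth_def mem_Collect_eq
proof (intro conjI allI)
  show "primitive_rec_fun (early f)"
    unfolding primitive_rec_fun_iff early_def min_eq_sum
    by (intro pr_intros dec_less_midpoint growthD(1) assms) auto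
  show "mono (early f)"
    unfolding early_def using mono_midpoint[of f] by (auto simp: mono_def min_le_iff_disj)
  show "\<exists>n. k \<le> early f n" for k
  proof -
    obtain n where n: "f k < f n" using growthD(3)[OF assms, of "Suc (f k)"] by (auto simp: Suc_le_eq)
    have le: "k \<le> n" using n monoD[OF growthD(2)[OF assms], of n k] by (meson le_cases not_le)
    have "f k < f (pause_start f n)" using n by (simp add: f_pause_start)
    then have "k \<le> pause_start f n"
      using monoD[OF growthD(2)[OF assms], of "pause_start f n" k] by (meson le_cases not_le)
    then have "k \<le> midpoint f n" unfolding midpoint_def using hier_gt le_trans less_imp_le by metis
    then show ?thesis using le by (auto simp: early_def)
  qed
qed

lemma late_growth: assumes "f \<in> growth" shows "late f \<in> growth"
  unfolding growth_def mem_Collect_eq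
proof (intro conjI allI)
  note f = growthD[OF assms]
  show "primitive_rec_fun (late f)"
    unfolding primitive_rec_fun_iff late_def
    by (intro pr_intros dec_less_midpoint pr_pause_start f(1)) auto
  show "mono (late f)"
  proof (rule monoI)
    fix m n :: nat assume mn: "m \<le> n"
    show "late f m \<le> late f n"
    proof (cases "f m = f n")
      case True
      then show ?thesis
        using mn pause_start_eq[OF f(2) mn True] midpoint_eq[OF f(2) mn True] pause_start_le[of f m]
        by (auto simp: late_def)
    next
      case False
      then have "f m < f (pause_start f n)"
        using monoD[OF f(2) mn] by (simp add: f_pause_start)
      then have "m \<le> pause_start f n"
        using monoD[OF f(2), of "pause_start f n" m] by (meson le_cases not_le)
      then show ?thesis using mn pause_start_le[of f m] by (auto simp: late_def)
    qed
  qed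
  show "\<exists>n. k \<le> late f n" for k
  proof -
    obtain n where n: "f k < f n" using f(3)[of "Suc (f k)"] by (auto simp: Suc_le_eq)
    have "f k < f (pause_start f n)" using n by (simp add: f_pause_start)
    then have "k \<le> pause_start f n"
      using monoD[OF f(2), of "pause_start f n" k] by (meson le_cases not_le)
    then have "k \<le> late f n" using pause_start_le[of f n] by (auto simp: late_def)
    then show ?thesis by blast
  qed
qed

lemma max_early_late: "max (early f n) (late f n) = n"
  using pause_start_le[of f n] by (auto simp: early_def late_def)

lemma le_early_late:
  assumes "\<And>n. f n \<le> n"
  shows "f n \<le> early f n" "f n \<le> late f n"
proof -
  have "f n \<le> pause_start f n" using assms[of "pause_start f n"] by (simp add: f_pause_start)
  then show "f n \<le> early f n" "f n \<le> late f n"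
    using assms[of n] hier_gt[of "pause_start f n" "level f n"]
    by (auto simp: early_def late_def midpoint_def)
qed

text \<open>Take a counted pause with a level much larger than what the given comparisons need. Shortly after
  its start \<open>a\<close>, \<open>late f\<close> rests at \<open>a\<close>, hence so does \<open>d\<close>,
  and \<open>c\<close> must exceed \<open>a\<close>. Shortly after the midpoint \<open>x\<close>, \<open>early
  f\<close> rests at \<open>x\<close>, and \<open>d\<close> must exceed \<open>x\<close>. From then on both
  \<open>c\<close> and \<open>d\<close> are above \<open>a\<close>, while \<open>f\<close>, still in its
  pause, is at most \<open>a\<close>. So the minimum of \<open>c\<close> and \<open>d\<close> is not below
  \<open>f\<close>.\<close>

lemma early_late_no_split:
  assumes f: "f \<in> growth" "\<not> slower (\<lambda>n. n) f" "\<And>n. f n \<le> n"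
    and cd: "c \<in> growth" "d \<in> growth" "slower c (early f)" "slower d (late f)"
      "slower (\<lambda>n. n) (\<lambda>n. max (c n) (d n))" "slower (\<lambda>n. min (c n) (d n)) f"
  shows False
proof -
  note mono_f = growthD(2)[OF f(1)]
  note mono_c = growthD(2)[OF cd(1)] and mono_d = growthD(2)[OF cd(2)]
  obtain j1 where j1: "\<forall>i\<ge>j1. \<forall>n. c n \<le> early f (hier i n)"
    using slower_hier[OF cd(3) growthD(2)[OF early_growth[OF f(1)]]] by blast
  obtain j2 where j2: "\<forall>i\<ge>j2. \<forall>n. d n \<le> late f (hier i n)"
    using slower_hier[OF cd(4) growthD(2)[OF late_growth[OF f(1)]]] by blast
  obtain j3 where j3: "\<forall>i\<ge>j3. \<forall>n. n \<le> max (c (hier i n)) (d (hier i n))"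
    using slower_hier[OF cd(5) growthD(2)[OF growth_max[OF cd(1,2)]]] by blast
  obtain j4 where j4: "\<forall>i\<ge>j4. \<forall>n. min (c n) (d n) \<le> f (hier i n)"
    using slower_hier[OF cd(6) mono_f] by blast
  define p where "p = hier (max (max j1 j2) (max j3 j4))"
  have p: "c n \<le> early f (p n)" "d n \<le> late f (p n)" "n \<le> max (c (p n)) (d (p n))"
    "min (c n) (d n) \<le> f (p n)" for n
    using j1 j2 j3 j4 by (auto simp: p_def)
  have "primitive_rec_fun p" unfolding p_def by (rule primitive_rec_fun_hier)
  then have "primitive_rec_fun (\<lambda>n. Suc (p (p (Suc n))))"
    unfolding primitive_rec_fun_iff by (intro pr_intros pr_app[of p]) (auto simp: primitive_rec_fun_iff)
  from primitive_rec_fun_dominated[OF this] obtain k where k: "\<And>n. p (p (Suc n)) < hier k n"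
    by (auto simp: Suc_le_eq)
  \<comment> \<open>Such a pause has room for two applications of level \<open>k\<close>, one up to the midpoint and one beyond it.\<close>
  obtain t where t: "level f t = k" "hier (Suc k) (pause_start f t) \<le> t"
    using pause_at_level[OF f(1,2)] by blast
  define a where "a = pause_start f t"
  define x where "x = hier k a"
  have x: "hier k x \<le> t" "a < x" "x < hier k x"
    using t(2) hier_hier_le[of k a] hier_gt unfolding x_def a_def by auto
  have pause: "f u = f a \<and> pause_start f u = a \<and> midpoint f u = x" if "a \<le> u" "u \<le> t" for u
  proof -
    have fa: "f a = f t" by (simp add: a_def f_pause_start)
    then have "f u = f t" using that monoD[OF mono_f, of a u] monoD[OF mono_f, of u t] by simp
    then show ?thesis
      using fa pause_start_eq[OF mono_f that(2)] midpoint_eq[OF mono_f that(2)] t(1)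
      by (simp add: a_def x_def midpoint_def)
  qed
  have p_gt: "n < p n" for n unfolding p_def by (rule hier_gt)
  let ?t1 = "p (Suc a)" and ?t2 = "p (Suc x)"
  have u1: "a \<le> p ?t1" "p ?t1 < x" "p ?t1 \<le> t"
    using p_gt[of "Suc a"] p_gt[of ?t1] k[of a] x by (auto simp: x_def)
  have "d ?t1 \<le> a" using p(2)[of ?t1] pause[OF u1(1,3)] u1(2) by (simp add: late_def)
  then have c1: "Suc a \<le> c ?t1" using p(3)[of "Suc a"] by simp
  have u2: "a \<le> p ?t2" "p ?t2 \<le> t"
    using p_gt[of "Suc x"] p_gt[of ?t2] k[of x] x by auto
  have "c ?t2 \<le> x" using p(1)[of ?t2] pause[OF u2] by (simp add: early_def)
  then have d2: "Suc x \<le> d ?t2" using p(3)[of "Suc x"] by simp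
  have "?t1 \<le> ?t2" unfolding p_def using x by (intro hier_mono) simp
  then have "Suc a \<le> min (c ?t2) (d ?t2)" using c1 d2 x(2) monoD[OF mono_c, of ?t1 ?t2] by simp
  also have "\<dots> \<le> f a" using p(4)[of ?t2] pause[OF u2] by simp
  also have "\<dots> \<le> a" by (rule f(3))
  finally show False by simp
qed

lemma smooth_growth: assumes "f \<in> growth" shows "smooth f \<in> growth"
proof -
  have "class_count (R_of (stalls f)) = smooth f" using class_count_R_of_stalls[OF growthD(2)[OF assms]] by blast
  then show ?thesis using class_count_growth[OF punctual_R_of_stalls(1)[OF assms]] by simp
qed

lemma not_splits_covers_growth: "\<not> splits_covers growth slower"
proof
  assume "splits_covers growth slower"
  then obtain f where f: "f \<in> growth" "\<exists>d\<in>growth. \<not> slower d f"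
    and split: "\<And>a b. a \<in> growth \<Longrightarrow> b \<in> growth \<Longrightarrow> slower f a \<Longrightarrow> slower f b \<Longrightarrow>
      joins_to_top growth slower a b \<Longrightarrow>
      (\<exists>c\<in>growth. \<exists>d\<in>growth. slower c a \<and> slower d b \<and> joins_to_top growth slower c d \<and>
          (\<forall>l\<in>growth. slower l c \<longrightarrow> slower l d \<longrightarrow> slower l f))"
    unfolding splits_covers_def by blast
  \<comment> \<open>The equivalent function \<open>smooth f\<close> lies below the identity, as \<open>le_early_late\<close> requires.\<close>
  define g where "g = smooth f"
  have g: "g \<in> growth" "slower f g" "slower g f" 
    unfolding g_def using smooth_growth slower_smooth smooth_slower f(1) by auto
  have g_le: "g n \<le> n" for n unfolding g_def by (induction n) auto
  have g_not_top: "\<not> slower (\<lambda>n. n) g"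
    using f(2) slower_trans slower_id g(3) by blast
  have "joins_to_top growth slower (early g) (late g)"
    unfolding joins_to_top_def
  proof (intro ballI impI)
    fix u e assume u: "u \<in> growth" "slower (early g) u" "slower (late g) u" and e: "e \<in> growth"
    have "slower (\<lambda>n. n) u"
      using max_slower[OF u(2,3) growthD(2)[OF u(1)]] by (simp add: max_early_late)
    then show "slower e u" using slower_trans slower_id[OF e] by blast
  qed
  moreover have "slower f (early g)" "slower f (late g)"
    using slower_trans[OF g(2)] slower_pointwise le_early_late[of g] g_le by blast+
  ultimately obtain c d where cd: "c \<in> growth" "d \<in> growth" "slower c (early g)" "slower d (late g)"
      "joins_to_top growth slower c d" "\<And>l. l \<in> growth \<Longrightarrow> slower l c \<Longrightarrow> slower l d \<Longrightarrow> slower l f"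
    using split[OF early_growth[OF g(1)] late_growth[OF g(1)]] by blast
  have "slower (\<lambda>n. n) (\<lambda>n. max (c n) (d n))"
    by (rule joins_to_top_max[OF cd(5) growth_max[OF cd(1,2)] id_growth])
  moreover have "slower (\<lambda>n. min (c n) (d n)) g"
    by (rule slower_trans[OF cd(6)[OF growth_min[OF cd(1,2)]] g(2)])
      (rule slower_pointwise, simp)+
  ultimately show False using early_late_no_split[OF g(1) g_not_top g_le cd(1-4)] by blast
qed

section \<open>Transfer to degrees\<close>

lemma class_count_Id: "class_count Id = (\<lambda>n. n)"
proof
  show "class_count Id n = n" for n by (induction n) (auto simp: class_count_Suc is_class_rep_def)
qed

lemma punctual_Id: "punctual Id"
proof -
  have eq: "equiv UNIV (Id :: nat rel)" by (auto simp: equiv_def refl_on_def sym_def trans_def)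
  have "infinite (UNIV // (Id :: nat rel))" using infinite_classes_iff[OF eq] class_count_Id by auto
  moreover have "primitive_rec_rel Id"
    unfolding primitive_rec_rel_iff pair_in_Id_conv by (intro pr_intros) auto
  ultimately show ?thesis unfolding punctual_def using eq by blast
qed

lemma lowercone_not_isomorphic:
  assumes R: "punctual R" and not_top: "\<not> Id \<le>\<^sub>p\<^sub>r R"
  shows "\<not> deg_order_isomorphic (lowercone R) Peq"
proof
  let ?D = "{f \<in> growth. slower f (class_count R)}"
  assume "deg_order_isomorphic (lowercone R) Peq"
  then obtain h where bij: "bij_betw h (lowercone R) Peq"
    and iso: "\<forall>d\<in>lowercone R. \<forall>e\<in>lowercone R. deg_le d e \<longleftrightarrow> deg_le (h d) (h e)"
    unfolding deg_order_isomorphic_def by (elim exE conjE)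
  have h: "h ` lowercone R = Peq" using bij by (rule bij_betw_imp_surj_on)
  have "\<not> slower (\<lambda>n. n) (class_count R)"
    using not_top pr_reducible_iff_slower_class_count[OF punctual_Id R] by (simp add: class_count_Id)
  then have split: "splits_covers ?D slower" using splits_covers_cone class_count_growth R by blast
  have degrees:
    "splits_covers (growth_deg ` A) deg_le \<longleftrightarrow> splits_covers A slower" if "A \<subseteq> growth" for A
    by (rule splits_covers_image) (use that in \<open>auto intro!: deg_le_growth_deg_iff\<close>)
  have cone: "splits_covers (lowercone R) deg_le \<longleftrightarrow> splits_covers ?D slower"
    unfolding lowercone_eq_growth_deg[OF R] by (rule degrees) blast
  have "splits_covers (h ` lowercone R) deg_le \<longleftrightarrow> splits_covers (lowercone R) deg_le"
    by (rule splits_covers_image) (use iso in simp)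
  then have "splits_covers Peq deg_le"
    using cone split by (simp add: h)
  then show False
    using degrees[of growth] not_splits_covers_growth by (simp add: Peq_eq_growth_deg)
qed

theorem corollary9p22:
  shows "(\<forall>X. punctual (R_of X) \<and> \<not> (R_of X \<equiv>\<^sub>p\<^sub>r Id) \<longrightarrow>
            \<not> deg_order_isomorphic (lowercone (R_of X)) Peq)
       \<and> (\<forall>R. punctual R \<and> lowercone R \<noteq> Peq \<longrightarrow>
            \<not> deg_order_isomorphic (lowercone R) Peq)"
proof (intro conjI allI impI; elim conjE)
  have below_Id: "R \<le>\<^sub>p\<^sub>r Id" if "punctual R" for R
    using pr_reducible_iff_slower_class_count[OF that punctual_Id] slower_id[OF class_count_growth[OF that]]
    by (simp add: class_count_Id)
  show "\<not> deg_order_isomorphic (lowercone (R_of X)) Peq"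
    if "punctual (R_of X)" "\<not> (R_of X \<equiv>\<^sub>p\<^sub>r Id)" for X
    using that lowercone_not_isomorphic below_Id unfolding pr_equivalent_def by blast
  show "\<not> deg_order_isomorphic (lowercone R) Peq" if R: "punctual R" and ne: "lowercone R \<noteq> Peq" for R
  proof (rule lowercone_not_isomorphic[OF R], rule notI)
    assume "Id \<le>\<^sub>p\<^sub>r R"
    then have "slower (\<lambda>n. n) (class_count R)"
      using pr_reducible_iff_slower_class_count[OF punctual_Id R] by (simp add: class_count_Id)
    then have "{f \<in> growth. slower f (class_count R)} = growth" using slower_trans slower_id by blast
    then show False using ne lowercone_eq_growth_deg[OF R] Peq_eq_growth_deg by simp
  qed
qed

end
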